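(* Let $L\in\mathbb{Q}^n$ be a weight vector on $R_A$ and $I_A^L:=\operatorname{gr}^L(I_A)\subseteq R_A$. (a) The set of $\mathbb{Z}^d$-graded prime ideals of $R_A$ containing $I_A^L$ equals $\{I_A^\tau:\tau\in\Phi_A^L\}$. (b) One has $$\operatorname{Var}(I_A^L)=\bigcup_{\tau\in\Phi_A^{L,d-1}}\overline{O_A^\tau}=\bigsqcup_{\tau\in\Phi_A^L}O_A^\tau\subseteq\widehat{\mathbb{C}}^n,$$ where $\Phi_A^{L,d-1}$ is the set of $(d-1)$-dimensional faces in $\Phi_A^L$.
   Context: $A=(\mathbf a_1,\dots,\mathbf a_n)\in\mathbb{Z}^{d\times n}$ is full ($\mathbb{Z}A=\mathbb{Z}^d$) and pointed. $R_A=\mathbb{C}[\partial_1,\dots,\partial_n]$ is $\mathbb{Z}^d$-graded by $\deg\partial_j=\mathbf a_j$. $I_A$ is the toric ideal, generated by $\partial^{\mathbf u_+}-\partial^{\mathbf u_-}$ for $\mathbf u\in\ker_{\mathbb{Z}}A$. For a weight $L\in\mathbb{Q}^n$, $\operatorname{gr}^L(I_A)$ is the ideal generated by the $L$-initial forms (the parts of maximal $L$-weight) of the elements of $I_A$. The torus $\mathbb{T}=(\mathbb{C}^* )^d$ acts on $\widehat{\mathbb{C}}^n=\operatorname{Spec}R_A$ by $\eta\cdot\xi=(\eta^{\mathbf a_1}\xi_1,\dots,\eta^{\mathbf a_n}\xi_n)$. Subsets $\tau$ of columns of $A$ are identified with index sets. For such $\tau$: - $I_A^\tau$ is the kernel of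 the map $R_A\to\mathbb{C}[t_1^{\pm1},\dots,t_d^{\pm1}]$ with $\partial_j\mapsto t^{\mathbf a_j}$ if $\mathbf a_j\in\tau$ and $\partial_j\mapsto0$ otherwise; - $\mathbf 1_\tau\in\widehat{\mathbb{C}}^n$ is the $0/1$ indicator vector of $\tau$, and $O_A^\tau$ is its $\mathbb{T}$-orbit, with closure $\overline{O_A^\tau}$. $(A,L)$-umbrella. Embed $\mathbb{Q}^d\subseteq\mathbb{P}^d_{\mathbb{Q}}$ via $\mathbf a\mapsto(1:\mathbf a)$ and set $\mathbf a_j^L:=(L_j:\mathbf a_j)$, informally $\mathbf a_j/L_j$, a point at infinity if $L_j=0$. Choose a linear form $f:\mathbb{Z}^d\to\mathbb{Z}$ with $f(\mathbf a_j)>0$ for all $j$, and $\varepsilon>0$ with $f(\mathbf a_j)>\varepsilon|L_j|$ for all $j$. Let $H_\varepsilon=\{(x_0:x):f(x)=-\varepsilon x_0\}$. The $(A,L)$-polyhedron $\Delta_A^L$ is the convex hull of $\{\mathbf 0,\mathbf a_1^L,\dots,\mathbf a_n^L\}$ in the affine space $\mathbb{P}^d_{\mathbb{Q}}\smallsetminus H_\varepsilon$. The $(A,L)$-umbrella $\Phi_A^L$ is the set of faces of $\Delta_A^L$ not containing $\mathbf 0$; each face is identified with the set of $j$ such that $\mathbf a_j^L$ lies on it. *)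

theory Defs
  imports "HOL-Analysis.Analysis" "HOL-Library.Poly_Mapping"
begin

type_synonym 'n mpoly = "('n \<Rightarrow>\<^sub>0 nat) \<Rightarrow>\<^sub>0 complex"

(* The matrix A is given by its columns A j \<in> Z^d, j ranging over the finite type 'n. *)

definition is_full :: "('n::finite \<Rightarrow> int^'d::finite) \<Rightarrow> bool" where
  "is_full A \<longleftrightarrow> (\<forall>v::int^'d. \<exists>c::'n \<Rightarrow> int. v = (\<Sum>j\<in>UNIV. c j *s A j))"

definition lin_form :: "int^'d::finite \<Rightarrow> int^'d \<Rightarrow> int" where
  "lin_form h a = (\<Sum>i\<in>UNIV. h $ i * a $ i)"

definition is_pointed :: "('n::finite \<Rightarrow> int^'d::finite) \<Rightarrow> bool" where
  "is_pointed A \<longleftrightarrow> (\<exists>h::int^'d. \<forall>j. lin_form h (A j) > 0)"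

definition mdeg :: "('n::finite \<Rightarrow> int^'d::finite) \<Rightarrow> ('n \<Rightarrow>\<^sub>0 nat) \<Rightarrow> int^'d" where
  "mdeg A m = (\<Sum>j\<in>UNIV. int (Poly_Mapping.lookup m j) *s A j)"

definition is_ideal :: "'a::comm_ring_1 set \<Rightarrow> bool" where
  "is_ideal I \<longleftrightarrow> 0 \<in> I \<and> (\<forall>x\<in>I. \<forall>y\<in>I. x + y \<in> I) \<and> (\<forall>r. \<forall>x\<in>I. r * x \<in> I)"

definition gen_ideal :: "'a::comm_ring_1 set \<Rightarrow> 'a set" where
  "gen_ideal S = \<Inter>{I. is_ideal I \<and> S \<subseteq> I}"

definition is_prime_ideal :: "'a::comm_ring_1 set \<Rightarrow> bool" where
  "is_prime_ideal P \<longleftrightarrow> is_ideal P \<and> 1 \<notin> P \<and> (\<forall>x y. x * y \<in> P \<longrightarrow> x \<in> P \<or> y \<in> P)"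

definition hom_comp :: "('n::finite \<Rightarrow> int^'d::finite) \<Rightarrow> int^'d \<Rightarrow> 'n mpoly \<Rightarrow> 'n mpoly" where
  "hom_comp A b f = (\<Sum>m\<in>{m\<in>Poly_Mapping.keys f. mdeg A m = b}. Poly_Mapping.single m (Poly_Mapping.lookup f m))"

definition is_graded :: "('n::finite \<Rightarrow> int^'d::finite) \<Rightarrow> 'n mpoly set \<Rightarrow> bool" where
  "is_graded A I \<longleftrightarrow> (\<forall>f\<in>I. \<forall>b. hom_comp A b f \<in> I)"

definition mono :: "('n \<Rightarrow>\<^sub>0 nat) \<Rightarrow> 'n mpoly" where
  "mono m = Poly_Mapping.single m 1"

definition pos_part :: "('n::finite \<Rightarrow> int) \<Rightarrow> 'n \<Rightarrow>\<^sub>0 nat" where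
  "pos_part u = (\<Sum>j\<in>UNIV. Poly_Mapping.single j (nat (u j)))"

definition neg_part :: "('n::finite \<Rightarrow> int) \<Rightarrow> 'n \<Rightarrow>\<^sub>0 nat" where
  "neg_part u = (\<Sum>j\<in>UNIV. Poly_Mapping.single j (nat (- u j)))"

definition int_kernel :: "('n::finite \<Rightarrow> int^'d::finite) \<Rightarrow> ('n \<Rightarrow> int) set" where
  "int_kernel A = {u. (\<Sum>j\<in>UNIV. u j *s A j) = 0}"

definition toric_ideal :: "('n::finite \<Rightarrow> int^'d::finite) \<Rightarrow> 'n mpoly set" where
  "toric_ideal A = gen_ideal {mono (pos_part u) - mono (neg_part u) | u. u \<in> int_kernel A}"

definition lweight :: "('n::finite \<Rightarrow> rat) \<Rightarrow> ('n \<Rightarrow>\<^sub>0 nat) \<Rightarrow> rat" where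
  "lweight L m = (\<Sum>j\<in>UNIV. L j * of_nat (Poly_Mapping.lookup m j))"

definition init_form :: "('n::finite \<Rightarrow> rat) \<Rightarrow> 'n mpoly \<Rightarrow> 'n mpoly" where
  "init_form L f = (if f = 0 then 0 else
     (\<Sum>m\<in>{m\<in>Poly_Mapping.keys f. lweight L m = Max (lweight L ` Poly_Mapping.keys f)}. Poly_Mapping.single m (Poly_Mapping.lookup f m)))"

definition grL :: "('n::finite \<Rightarrow> rat) \<Rightarrow> 'n mpoly set \<Rightarrow> 'n mpoly set" where
  "grL L I = gen_ideal (init_form L ` I)"

(* The map R_A \<rightarrow> C[t^{\<pm>1}] (Laurent polynomial ring = group algebra of Z^d),
   d_j \<mapsto> t^{a_j} if j \<in> \<tau>, d_j \<mapsto> 0 otherwise, and its kernel I_A^\<tau>. *)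
definition laurent_map :: "('n::finite \<Rightarrow> int^'d::finite) \<Rightarrow> 'n set \<Rightarrow> 'n mpoly \<Rightarrow> (int^'d \<Rightarrow>\<^sub>0 complex)" where
  "laurent_map A \<tau> f = (\<Sum>m\<in>Poly_Mapping.keys f. Poly_Mapping.single 0 (Poly_Mapping.lookup f m) *
      (\<Prod>j\<in>UNIV. (if j \<in> \<tau> then Poly_Mapping.single (A j) 1 else 0) ^ Poly_Mapping.lookup m j))"

definition I_tau :: "('n::finite \<Rightarrow> int^'d::finite) \<Rightarrow> 'n set \<Rightarrow> 'n mpoly set" where
  "I_tau A \<tau> = {f. laurent_map A \<tau> f = 0}"

definition peval :: "'n::finite mpoly \<Rightarrow> complex^'n \<Rightarrow> complex" where
  "peval f \<xi> = (\<Sum>m\<in>Poly_Mapping.keys f. Poly_Mapping.lookup f m * (\<Prod>j\<in>UNIV. (\<xi> $ j) ^ Poly_Mapping.lookup m j))"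

definition zero_set :: "'n::finite mpoly set \<Rightarrow> (complex^'n) set" where
  "zero_set I = {\<xi>. \<forall>f\<in>I. peval f \<xi> = 0}"

definition orbit :: "('n::finite \<Rightarrow> int^'d::finite) \<Rightarrow> 'n set \<Rightarrow> (complex^'n) set" where
  "orbit A \<tau> = {(\<chi> j. (\<Prod>i\<in>UNIV. (\<eta> $ i) powi (A j $ i)) * (if j \<in> \<tau> then 1 else 0)) | \<eta>::complex^'d.
                 \<forall>i. \<eta> $ i \<noteq> 0}"

(* The (A,L)-umbrella. The affine space P^d \ H_eps is identified with the affine hyperplane
   {(y0,y) \<in> R x R^d. eps*y0 + f(y) = 1}, a point (x0:x) being represented by
   (x0,x)/(eps*x0 + f(x)). *)
definition aff_pt :: "int^'d::finite \<Rightarrow> rat \<Rightarrow> real \<Rightarrow> real^'d \<Rightarrow> real \<times> (real^'d)" where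
  "aff_pt h \<epsilon> x0 x = (1 / (real_of_rat \<epsilon> * x0 + (\<Sum>i\<in>UNIV. real_of_int (h $ i) * x $ i))) *\<^sub>R (x0, x)"

definition origin_pt :: "int^'d::finite \<Rightarrow> rat \<Rightarrow> real \<times> (real^'d)" where
  "origin_pt h \<epsilon> = aff_pt h \<epsilon> 1 0"

definition col_pt :: "('n::finite \<Rightarrow> int^'d::finite) \<Rightarrow> ('n \<Rightarrow> rat) \<Rightarrow> int^'d \<Rightarrow> rat \<Rightarrow> 'n \<Rightarrow> real \<times> (real^'d)" where
  "col_pt A L h \<epsilon> j = aff_pt h \<epsilon> (real_of_rat (L j)) (\<chi> i. real_of_int (A j $ i))"

definition AL_polyhedron :: "('n::finite \<Rightarrow> int^'d::finite) \<Rightarrow> ('n \<Rightarrow> rat) \<Rightarrow> int^'d \<Rightarrow> rat \<Rightarrow> (real \<times> (real^'d)) set" where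
  "AL_polyhedron A L h \<epsilon> = convex hull (insert (origin_pt h \<epsilon>) (range (col_pt A L h \<epsilon>)))"

definition umbrella :: "('n::finite \<Rightarrow> int^'d::finite) \<Rightarrow> ('n \<Rightarrow> rat) \<Rightarrow> int^'d \<Rightarrow> rat \<Rightarrow> 'n set set" where
  "umbrella A L h \<epsilon> = {{j. col_pt A L h \<epsilon> j \<in> F} | F.
       F face_of AL_polyhedron A L h \<epsilon> \<and> origin_pt h \<epsilon> \<notin> F}"

definition umbrella_dim :: "('n::finite \<Rightarrow> int^'d::finite) \<Rightarrow> ('n \<Rightarrow> rat) \<Rightarrow> int^'d \<Rightarrow> rat \<Rightarrow> int \<Rightarrow> 'n set set" where
  "umbrella_dim A L h \<epsilon> k = {{j. col_pt A L h \<epsilon> j \<in> F} | F.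
       F face_of AL_polyhedron A L h \<epsilon> \<and> origin_pt h \<epsilon> \<notin> F \<and> aff_dim F = k}"

end

theory Submission
  imports Defs
begin

text \<open>
  The faces of the polyhedron that miss the origin correspond to the sets \<open>\<tau>\<close> for which some
  \<open>u\<close> satisfies \<open>u \<bullet> a\<^sub>j = L\<^sub>j\<close> on \<open>\<tau>\<close> and \<open>u \<bullet> a\<^sub>j < L\<^sub>j\<close> off \<open>\<tau>\<close>: rescale a supporting functional so
  that its coordinate dual to the origin is 1.

  Given such a \<open>u\<close>, every monomial of degree \<open>b\<close> has weight at least \<open>u \<bullet> b\<close>, with equality exactly
  for the monomials supported on \<open>\<tau>\<close>. Hence passing to initial forms preserves the vanishing of
  the degreewise coefficient sums over these monomials, and the initial ideal lies in \<open>I_tau A \<tau>\<close>.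

  Conversely let \<open>P\<close> be a prime containing the initial ideal and \<open>\<tau>\<close> the set of variables outside
  \<open>P\<close>. If no \<open>u\<close> exists, Motzkin's transposition theorem over the rationals yields a lattice
  relation whose binomial has an initial form that forces a monomial supported on \<open>\<tau>\<close> into \<open>P\<close>.
  Modulo \<open>P\<close> every homogeneous element is a multiple of one monomial supported on \<open>\<tau>\<close>, so a graded
  \<open>P\<close> equals \<open>I_tau A \<tau>\<close>. For the prime of a point with support \<open>\<tau>\<close>, the binomials say that its
  coordinates define a character of the lattice spanned by \<open>\<tau>\<close>; it extends to \<open>\<int>\<^sup>d\<close> because
  \<open>\<complex>\<^sup>*\<close> is divisible, and so the point lies in the orbit of \<open>\<tau>\<close>.

  A maximal \<open>\<tau>' \<supseteq> \<tau>\<close>, with witness \<open>u'\<close>, spans \<open>\<real>\<^sup>d\<close> and thus is a facet; the one-parameter group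
  with exponent \<open>u' - u\<close> degenerates its orbit to that of \<open>\<tau>\<close>.
\<close>

section \<open>Ring homomorphisms out of monoid algebras\<close>

abbreviation coef :: "('k \<Rightarrow>\<^sub>0 'c::zero) \<Rightarrow> 'k \<Rightarrow> 'c" where
  "coef \<equiv> Poly_Mapping.lookup"

abbreviation supp :: "('k \<Rightarrow>\<^sub>0 'c::zero) \<Rightarrow> 'k set" where
  "supp \<equiv> Poly_Mapping.keys"

text \<open>The additive map sending \<open>c\<close> times the monomial \<open>m\<close> to
  \<open>\<kappa> c * T m\<close>. The Laurent map, evaluation at a point and evaluation of
  characters are all instances, so one locale settles their homomorphism and kernel
  properties.\<close>

definition lin_ext :: "('c::zero \<Rightarrow> 'r::comm_ring_1) \<Rightarrow> ('k \<Rightarrow> 'r) \<Rightarrow> ('k \<Rightarrow>\<^sub>0 'c) \<Rightarrow> 'r" where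
  "lin_ext \<kappa> T f = (\<Sum>m\<in>supp f. \<kappa> (coef f m) * T m)"

lemma poly_mapping_sum_single: "f = (\<Sum>m\<in>supp f. Poly_Mapping.single m (coef f m))"
  by (rule poly_mapping_eqI) (auto simp: lookup_sum lookup_single when_def in_keys_iff)

lemma exponent_sum_single: "(m :: 'n::finite \<Rightarrow>\<^sub>0 nat) = (\<Sum>j\<in>UNIV. Poly_Mapping.single j (coef m j))"
  by (rule poly_mapping_eqI) (auto simp: lookup_sum lookup_single when_def)

locale monoid_ring_hom =
  fixes \<kappa> :: "'c::comm_ring_1 \<Rightarrow> 'r::comm_ring_1" and T :: "'k::comm_monoid_add \<Rightarrow> 'r"
  assumes \<kappa>_0: "\<kappa> 0 = 0" and \<kappa>_1: "\<kappa> 1 = 1"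
    and \<kappa>_add: "\<kappa> (a + b) = \<kappa> a + \<kappa> b" and \<kappa>_mult: "\<kappa> (a * b) = \<kappa> a * \<kappa> b"
    and T_0: "T 0 = 1" and T_add: "T (m + m') = T m * T m'"
begin

lemma lin_ext_superset:
  assumes "finite S" "supp f \<subseteq> S"
  shows "lin_ext \<kappa> T f = (\<Sum>m\<in>S. \<kappa> (coef f m) * T m)"
  unfolding lin_ext_def using assms
    by (intro sum.mono_neutral_left) (auto simp: in_keys_iff \<kappa>_0)

lemma lin_ext_add: "lin_ext \<kappa> T (f + g) = lin_ext \<kappa> T f + lin_ext \<kappa> T g"
proof -
  have s: "finite (supp f \<union> supp g)" "supp (f + g) \<subseteq> supp f \<union> supp g"
    by (simp, rule Poly_Mapping.keys_add)
  show ?thesis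
    using lin_ext_superset[OF s] lin_ext_superset[OF s(1), of f] lin_ext_superset[OF s(1), of g]
    by (simp add: lookup_add \<kappa>_add distrib_right sum.distrib)
qed

lemma lin_ext_0: "lin_ext \<kappa> T 0 = 0"
  by (simp add: lin_ext_def)

lemma lin_ext_single: "lin_ext \<kappa> T (Poly_Mapping.single m c) = \<kappa> c * T m"
  by (simp add: lin_ext_def \<kappa>_0)

lemma lin_ext_1: "lin_ext \<kappa> T 1 = 1"
  using lin_ext_single[of 0 1] by (simp add: \<kappa>_1 T_0)

lemma lin_ext_sum: "lin_ext \<kappa> T (\<Sum>i\<in>S. f i) = (\<Sum>i\<in>S. lin_ext \<kappa> T (f i))"
  by (induction S rule: infinite_finite_induct) (auto simp: lin_ext_0 lin_ext_add)

lemma lin_ext_diff: "lin_ext \<kappa> T (f - g) = lin_ext \<kappa> T f - lin_ext \<kappa> T g"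
  using lin_ext_add[of "f - g" g] by simp

lemma lin_ext_mult: "lin_ext \<kappa> T (f * g) = lin_ext \<kappa> T f * lin_ext \<kappa> T g"
proof -
  have "f * g = (\<Sum>m\<in>supp f. \<Sum>m'\<in>supp g. Poly_Mapping.single (m + m') (coef f m * coef g m'))"
    by (subst poly_mapping_sum_single[of f], subst poly_mapping_sum_single[of g])
      (simp add: sum_product mult_single)
  then have "lin_ext \<kappa> T (f * g) =
      (\<Sum>m\<in>supp f. \<Sum>m'\<in>supp g. \<kappa> (coef f m * coef g m') * T (m + m'))"
    by (simp add: lin_ext_sum lin_ext_single)
  also have "\<dots> = lin_ext \<kappa> T f * lin_ext \<kappa> T g"
    by (simp add: lin_ext_def sum_product \<kappa>_mult T_add mult_ac)
  finally show ?thesis .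
qed

lemma is_ideal_kernel: "is_ideal {f. lin_ext \<kappa> T f = 0}"
  by (auto simp: is_ideal_def lin_ext_0 lin_ext_add lin_ext_mult)

lemma is_prime_ideal_kernel:
  assumes "\<And>f g. lin_ext \<kappa> T f * lin_ext \<kappa> T g = 0 \<Longrightarrow> lin_ext \<kappa> T f = 0 \<or> lin_ext \<kappa> T g = 0"
  shows "is_prime_ideal {f. lin_ext \<kappa> T f = 0}"
  using assms is_ideal_kernel by (auto simp: is_prime_ideal_def lin_ext_1 lin_ext_mult)

end

section \<open>Separating lattice vectors by a linear form\<close>

lemma lin_form_add: "lin_form c (x + y) = lin_form c x + lin_form c y"
  by (simp add: lin_form_def distrib_left sum.distrib)

lemma lin_form_diff: "lin_form c (x - y) = lin_form c x - lin_form c y"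
  by (simp add: lin_form_def right_diff_distrib sum_subtractf)

text \<open>If the form \<open>c\<close> found so far kills the new vector \<open>x\<close>, then
  \<open>N *s c + x\<close> works: on \<open>x\<close> it is the sum of squares
  \<open>lin_form x x\<close>, and on \<open>D\<close> the multiple \<open>N\<close> of the nonzero
  integer \<open>lin_form c y\<close> outweighs \<open>lin_form x y\<close>.\<close>

lemma ex_lin_form_nonzero:
  fixes D :: "(int^'d::finite) set"
  assumes "finite D" "0 \<notin> D"
  shows "\<exists>c. \<forall>x\<in>D. lin_form c x \<noteq> 0"
  using assms
proof (induction D)
  case empty
  then show ?case by simp
next
  case (insert x D)
  then obtain c where c: "\<forall>y\<in>D. lin_form c y \<noteq> 0" by auto
  show ?case
  proof (cases "lin_form c x = 0")
    case False
    with c show ?thesis by auto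
  next
    case True
    define N where "N = 1 + (\<Sum>y\<in>D. \<bar>lin_form x y\<bar>)"
    define c' where "c' = N *s c + x"
    have c': "lin_form c' y = N * lin_form c y + lin_form x y" for y
      by (simp add: c'_def lin_form_def algebra_simps sum.distrib sum_distrib_left)
    have "x \<noteq> 0" using insert by auto
    then obtain i where i: "x $ i \<noteq> 0" by (auto simp: vec_eq_iff)
    have "lin_form x x > 0"
      unfolding lin_form_def by (rule sum_pos2[of _ i]) (use i in \<open>auto simp: zero_less_mult_iff\<close>)
    then have "lin_form c' x \<noteq> 0" using True by (simp add: c')
    moreover have "lin_form c' y \<noteq> 0" if y: "y \<in> D" for y
    proof
      assume z: "lin_form c' y = 0"
      have "\<bar>lin_form x y\<bar> < N"
        unfolding N_def using member_le_sum[of y D "\<lambda>y. \<bar>lin_form x y\<bar>"] y insert.hyps by auto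
      moreover have "\<bar>lin_form c y\<bar> \<ge> 1" using c y by force
      moreover have "\<bar>lin_form x y\<bar> = N * \<bar>lin_form c y\<bar>"
        using z \<open>\<bar>lin_form x y\<bar> < N\<close> abs_mult[of N "lin_form c y"]
          by (simp add: c')
      ultimately show False by (metis abs_ge_zero le_less_trans less_le_not_le mult_le_cancel_left1)
    qed
    ultimately show ?thesis by auto
  qed
qed

text \<open>A linear form that is injective on both supports maps the two factors injectively into
  Laurent polynomials in one variable.\<close>

lemma laurent_no_zero_divisors:
  fixes p q :: "int^'d::finite \<Rightarrow>\<^sub>0 'c::idom"
  assumes "p * q = 0"
  shows "p = 0 \<or> q = 0"
proof -
  \<comment> \<open>Nonvanishing on these differences is injectivity on each support.\<close>
  define D where "D = (\<lambda>(x, y). x - y) ` ((supp p \<times> supp p) \<union> (supp q \<times> supp q)) - {0}"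
  have "finite D" "0 \<notin> D" by (auto simp: D_def)
  then obtain c where c: "\<forall>x\<in>D. lin_form c x \<noteq> 0"
    using ex_lin_form_nonzero by blast
  have inj: "inj_on (lin_form c) (supp p)" "inj_on (lin_form c) (supp q)"
    using c unfolding D_def inj_on_def by (force simp: lin_form_diff)+
  let ?\<kappa> = "Poly_Mapping.single (0::int) :: 'c \<Rightarrow> _" and ?T = "\<lambda>m. Poly_Mapping.single (lin_form c m) (1::'c)"
  interpret monoid_ring_hom ?\<kappa> ?T
    by unfold_locales (auto simp: single_add mult_single lin_form_add, simp add: lin_form_def)
  have zero: "r = 0" if r: "lin_ext ?\<kappa> ?T r = 0" "inj_on (lin_form c) (supp r)" for r
  proof (rule ccontr)
    assume "r \<noteq> 0"
    then obtain m where m: "m \<in> supp r" by (metis keys_eq_empty ex_in_conv)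
    have "coef (lin_ext ?\<kappa> ?T r) (lin_form c m) = (\<Sum>m'\<in>supp r. if m' = m then coef r m else 0)"
      unfolding lin_ext_def lookup_sum
      by (rule sum.cong) (use r(2) m in \<open>auto simp: mult_single lookup_single when_def inj_on_def\<close>)
    also have "\<dots> = coef r m" using m by simp
    finally show False using r(1) m by (simp add: in_keys_iff)
  qed
  have "lin_ext ?\<kappa> ?T p * lin_ext ?\<kappa> ?T q = 0"
    using lin_ext_mult[of p q] assms by (simp add: lin_ext_0)
  \<comment> \<open>Exponents in the ordered group of integers leave the one-variable ring without
    zero divisors, so one of the two images is 0.\<close>
  then show ?thesis using zero inj by auto
qed

section \<open>The toric ideal and its initial ideal\<close>

lemma mdeg_add: "mdeg A (m + m') = mdeg A m + mdeg A m'"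
  by (simp add: mdeg_def lookup_add vector_sadd_rdistrib sum.distrib)

lemma mdeg_0: "mdeg A 0 = 0"
  by (simp add: mdeg_def)

lemma supp_add_nat: "supp (m + m' :: 'n \<Rightarrow>\<^sub>0 nat) = supp m \<union> supp m'"
  by (auto simp: in_keys_iff lookup_add)

text \<open>Closed form of the image of the monomial \<open>m\<close> under
  \<open>laurent_map\<close>: a variable outside \<tau> kills it.\<close>

definition tau_char :: "('n::finite \<Rightarrow> int^'d::finite) \<Rightarrow> 'n set \<Rightarrow> ('n \<Rightarrow>\<^sub>0 nat) \<Rightarrow> (int^'d \<Rightarrow>\<^sub>0 complex)" where
  "tau_char A \<tau> m = (if supp m \<subseteq> \<tau> then Poly_Mapping.single (mdeg A m) 1 else 0)"

lemma single_power: "Poly_Mapping.single (a :: int^'d::finite) (1::complex) ^ k = Poly_Mapping.single (int k *s a) 1"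
  by (induction k) (auto simp: mult_single vector_sadd_rdistrib)

lemma prod_single: "(\<Prod>j\<in>S. Poly_Mapping.single (g j) (1::complex)) = Poly_Mapping.single (\<Sum>j\<in>S. g j) 1"
  by (induction S rule: infinite_finite_induct) (auto simp: mult_single)

lemma tau_char_eq_prod:
  "(\<Prod>j\<in>UNIV. (if j \<in> \<tau> then Poly_Mapping.single (A j) 1 else 0) ^ coef m j) = tau_char A \<tau> m"
proof (cases "supp m \<subseteq> \<tau>")
  case True
  then have "(if j \<in> \<tau> then Poly_Mapping.single (A j) 1 else 0) ^ coef m j
      = Poly_Mapping.single (int (coef m j) *s A j) (1::complex)" for j
    by (cases "j \<in> \<tau>", simp add: single_power) (cases "coef m j = 0", auto simp: in_keys_iff subset_iff)
  with True show ?thesis by (simp add: tau_char_def prod_single mdeg_def)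
next
  case False
  then obtain j where "coef m j \<noteq> 0" "j \<notin> \<tau>" by (auto simp: in_keys_iff)
  then show ?thesis using False
    by (auto simp: tau_char_def zero_power intro!: prod_zero bexI[of _ j])
qed

lemma laurent_map_eq: "laurent_map A \<tau> = lin_ext (Poly_Mapping.single 0) (tau_char A \<tau>)"
  by (rule ext) (simp only: laurent_map_def lin_ext_def tau_char_eq_prod)

lemma laurent_map_hom: "monoid_ring_hom (Poly_Mapping.single 0) (tau_char A \<tau>)"
  by unfold_locales (auto simp: single_add mult_single tau_char_def mdeg_add mdeg_0 supp_add_nat)

lemma is_prime_ideal_I_tau: "is_prime_ideal (I_tau A \<tau>)"
  unfolding I_tau_def laurent_map_eq
  by (rule monoid_ring_hom.is_prime_ideal_kernel[OF laurent_map_hom])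
    (auto dest: laurent_no_zero_divisors)

lemma is_ideal_I_tau: "is_ideal (I_tau A \<tau>)"
  using is_prime_ideal_I_tau by (auto simp: is_prime_ideal_def)

text \<open>The coefficient at exponent \<open>b\<close> of the image of \<open>f\<close> under
  \<open>laurent_map\<close>. Membership in \<open>I_tau\<close> thus becomes the vanishing of sums
  of coefficients, one for each degree.\<close>

definition deg_sum :: "('n::finite \<Rightarrow> int^'d::finite) \<Rightarrow> 'n set \<Rightarrow> int^'d \<Rightarrow> 'n mpoly \<Rightarrow> complex" where
  "deg_sum A \<tau> b f = (\<Sum>m\<in>{m \<in> supp f. supp m \<subseteq> \<tau> \<and> mdeg A m = b}. coef f m)"

lemma coef_laurent_map: "coef (laurent_map A \<tau> f) b = deg_sum A \<tau> b f"
  unfolding laurent_map_eq lin_ext_def deg_sum_def lookup_sum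
  by (rule sum.mono_neutral_cong_right)
    (auto simp: tau_char_def mult_single lookup_single when_def)

lemma I_tau_iff: "f \<in> I_tau A \<tau> \<longleftrightarrow> (\<forall>b. deg_sum A \<tau> b f = 0)"
  by (simp add: I_tau_def poly_mapping_eq_iff coef_laurent_map fun_eq_iff)

lemma deg_sum_superset:
  assumes "finite S" "supp f \<subseteq> S"
  shows "deg_sum A \<tau> b f = (\<Sum>m\<in>S. if supp m \<subseteq> \<tau> \<and> mdeg A m = b then coef f m else 0)"
  unfolding deg_sum_def
  by (rule sum.mono_neutral_cong_left) (use assms in \<open>auto simp: in_keys_iff\<close>)

lemma coef_sum_single:
  assumes "finite S"
  shows "coef (\<Sum>m\<in>S. Poly_Mapping.single m (c m)) m' = (if m' \<in> S then c m' else 0)"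
  using assms by (simp add: lookup_sum lookup_single when_def)

lemma coef_hom_comp: "coef (hom_comp A b f) m = (if mdeg A m = b then coef f m else 0)"
  by (auto simp: hom_comp_def coef_sum_single in_keys_iff)

lemma supp_hom_comp: "supp (hom_comp A b f) = {m \<in> supp f. mdeg A m = b}"
  by (auto simp: in_keys_iff coef_hom_comp split: if_splits)

lemma is_graded_I_tau: "is_graded A (I_tau A \<tau>)"
proof -
  have "deg_sum A \<tau> b' (hom_comp A b f) = (if b = b' then deg_sum A \<tau> b f else 0)" for f b b'
    unfolding deg_sum_def supp_hom_comp coef_hom_comp
    by (auto intro!: sum.neutral sum.cong)
  then show ?thesis by (auto simp: is_graded_def I_tau_iff)
qed

section \<open>Binomials of the toric ideal and their initial forms\<close>

lemma gen_ideal_least: "is_ideal I \<Longrightarrow> S \<subseteq> I \<Longrightarrow> gen_ideal S \<subseteq> I"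
  by (auto simp: gen_ideal_def)

lemma gen_ideal_superset: "S \<subseteq> gen_ideal S"
  by (auto simp: gen_ideal_def)

lemma is_ideal_gen_ideal: "is_ideal (gen_ideal S)"
  by (auto simp: gen_ideal_def is_ideal_def)

lemma coef_pos_part: "coef (pos_part u) j = nat (u j)"
  by (simp add: pos_part_def lookup_sum lookup_single when_def)

lemma coef_neg_part: "coef (neg_part u) j = nat (- u j)"
  by (simp add: neg_part_def lookup_sum lookup_single when_def)

lemma mdeg_pos_neg_part: "mdeg A (pos_part u) - mdeg A (neg_part u) = (\<Sum>j\<in>UNIV. u j *s A j)"
  unfolding mdeg_def coef_pos_part coef_neg_part sum_subtractf[symmetric]
  by (rule sum.cong) (auto simp: vec_eq_iff left_diff_distrib[symmetric])

lemma lweight_pos_neg_part: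
  "lweight L (pos_part u) - lweight L (neg_part u) = (\<Sum>j\<in>UNIV. L j * of_int (u j))"
  unfolding lweight_def coef_pos_part coef_neg_part sum_subtractf[symmetric]
proof (rule sum.cong[OF refl])
  fix j
  show "L j * of_nat (nat (u j)) - L j * of_nat (nat (- u j)) = L j * of_int (u j)"
    by (cases "u j \<ge> 0") (auto simp: of_nat_nat)
qed

lemma mono_0: "mono 0 = 1"
  by (simp add: mono_def)

lemma mono_add: "mono (m + m') = mono m * mono m'"
  by (simp add: mono_def mult_single)

lemma laurent_map_mono: "laurent_map A \<tau> (mono m) = tau_char A \<tau> m"
  unfolding laurent_map_eq mono_def monoid_ring_hom.lin_ext_single[OF laurent_map_hom] by simp

lemma laurent_map_diff: "laurent_map A \<tau> (f - g) = laurent_map A \<tau> f - laurent_map A \<tau> g"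
  unfolding laurent_map_eq monoid_ring_hom.lin_ext_diff[OF laurent_map_hom] by simp

lemma toric_ideal_subset: "toric_ideal A \<subseteq> I_tau A UNIV"
  unfolding toric_ideal_def
proof (rule gen_ideal_least[OF is_ideal_I_tau])
  show "{mono (pos_part u) - mono (neg_part u) |u. u \<in> int_kernel A} \<subseteq> I_tau A UNIV"
    using mdeg_pos_neg_part[of A, unfolded diff_eq_eq]
    by (auto simp: I_tau_def laurent_map_diff laurent_map_mono tau_char_def int_kernel_def)
qed

text \<open>Dividing by the greatest common divisor of the two monomials leaves the generator
  belonging to the difference of the exponents.\<close>

lemma binomial_in_toric_ideal:
  assumes "mdeg A m = mdeg A m'"
  shows "mono m - mono m' \<in> toric_ideal A"
proof -
  define u where "u j = int (coef m j) - int (coef m' j)" for j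
  \<comment> \<open>The coordinatewise minimum of \<open>m\<close> and \<open>m'\<close>.\<close>
  define c where "c = m - pos_part u"
  have "m = c + pos_part u"
    by (rule poly_mapping_eqI) (auto simp: c_def lookup_add lookup_minus coef_pos_part u_def)
  moreover have "m' = c + neg_part u"
    by (rule poly_mapping_eqI)
      (auto simp: c_def lookup_add lookup_minus coef_pos_part coef_neg_part u_def)
  ultimately have m: "mono m - mono m' = mono c * (mono (pos_part u) - mono (neg_part u))"
    by (metis mono_add right_diff_distrib)
  have "(\<Sum>j\<in>UNIV. u j *s A j) = mdeg A m - mdeg A m'"
    unfolding mdeg_def sum_subtractf[symmetric]
    by (rule sum.cong) (auto simp: u_def vec_eq_iff left_diff_distrib)
  then have "u \<in> int_kernel A" using assms by (simp add: int_kernel_def)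
  then have "mono (pos_part u) - mono (neg_part u) \<in> toric_ideal A"
    unfolding toric_ideal_def by (intro subsetD[OF gen_ideal_superset]) blast
  then show ?thesis
    unfolding m toric_ideal_def using is_ideal_gen_ideal unfolding is_ideal_def by blast
qed

lemma coef_init_form:
  "coef (init_form L f) m = (if m \<in> supp f \<and> lweight L m = Max (lweight L ` supp f) then coef f m else 0)"
  by (auto simp: init_form_def coef_sum_single)

lemma coef_mono: "coef (mono m) k = (if k = m then 1 else 0)"
  by (auto simp: mono_def lookup_single when_def)

lemma coef_mono_diff:
  "coef (mono m - mono m') k = (if k = m then 1 else 0) - (if k = m' then 1 else 0)"
  by (simp add: lookup_minus coef_mono)

lemma supp_mono_diff: "m \<noteq> m' \<Longrightarrow> supp (mono m - mono m') = {m, m'}"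
  by (auto simp: in_keys_iff coef_mono_diff split: if_splits)

text \<open>The heavier monomial is the whole initial form of the binomial.\<close>

lemma mono_in_grL:
  assumes "mdeg A m = mdeg A m'" "lweight L m > lweight L m'"
  shows "mono m \<in> grL L (toric_ideal A)"
proof -
  have "m \<noteq> m'" using assms by auto
  then have "init_form L (mono m - mono m') = mono m"
    using assms(2)
    by (intro poly_mapping_eqI)
      (auto simp: coef_init_form supp_mono_diff coef_mono_diff max_def coef_mono)
  then show ?thesis
    using binomial_in_toric_ideal[OF assms(1)] unfolding grL_def
    by (intro subsetD[OF gen_ideal_superset]) (metis image_eqI)
qed

text \<open>A binomial with terms of equal weight is its own initial form.\<close>

lemma binomial_in_grL:
  assumes "mdeg A m = mdeg A m'" "lweight L m = lweight L m'"
  shows "mono m - mono m' \<in> grL L (toric_ideal A)"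
proof (cases "m = m'")
  case True
  then show ?thesis using is_ideal_gen_ideal by (auto simp: grL_def is_ideal_def)
next
  case False
  then have "init_form L (mono m - mono m') = mono m - mono m'"
    using assms(2)
    by (intro poly_mapping_eqI) (auto simp: coef_init_form supp_mono_diff coef_mono_diff)
  then show ?thesis
    using binomial_in_toric_ideal[OF assms(1)] unfolding grL_def
    by (intro subsetD[OF gen_ideal_superset]) (metis image_eqI)
qed

section \<open>Supporting functionals and weights\<close>

definition rcol :: "('n::finite \<Rightarrow> int^'d::finite) \<Rightarrow> 'n \<Rightarrow> real^'d" where
  "rcol A j = (\<chi> i. real_of_int (A j $ i))"

text \<open>Reading \<open>L j\<close> as a height over column \<open>j\<close>, the linear function
  \<open>u\<close> touches the heights exactly on \<tau> and stays strictly below them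
  elsewhere.\<close>

definition supports :: "('n::finite \<Rightarrow> int^'d::finite) \<Rightarrow> ('n \<Rightarrow> rat) \<Rightarrow> 'n set \<Rightarrow> real^'d \<Rightarrow> bool" where
  "supports A L \<tau> u \<longleftrightarrow> (\<forall>j. (j \<in> \<tau> \<longrightarrow> u \<bullet> rcol A j = real_of_rat (L j))
                          \<and> (j \<notin> \<tau> \<longrightarrow> u \<bullet> rcol A j < real_of_rat (L j)))"

lemma inner_mdeg:
  "u \<bullet> (\<chi> i. real_of_int (mdeg A m $ i)) = (\<Sum>j\<in>UNIV. (u \<bullet> rcol A j) * real (coef m j))"
proof -
  have "(\<chi> i. real_of_int (mdeg A m $ i)) = (\<Sum>j\<in>UNIV. real (coef m j) *\<^sub>R rcol A j)"
    by (simp add: vec_eq_iff mdeg_def rcol_def)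
  then show ?thesis by (simp add: inner_sum_right mult.commute)
qed

text \<open>The weight exceeds \<open>u\<close> on the degree by the sum of the slacks
  \<open>L j - u \<bullet> rcol A j\<close>, each times the exponent of \<open>j\<close>. All terms
  are nonnegative, and the slack is positive exactly off \<tau>.\<close>

lemma lweight_ge:
  assumes "supports A L \<tau> u"
  shows "u \<bullet> (\<chi> i. real_of_int (mdeg A m $ i)) \<le> real_of_rat (lweight L m)"
    and "u \<bullet> (\<chi> i. real_of_int (mdeg A m $ i)) = real_of_rat (lweight L m) \<longleftrightarrow> supp m \<subseteq> \<tau>"
proof -
  let ?g = "\<lambda>j. (real_of_rat (L j) - u \<bullet> rcol A j) * real (coef m j)"
  have eq: "real_of_rat (lweight L m) - u \<bullet> (\<chi> i. real_of_int (mdeg A m $ i)) = (\<Sum>j\<in>UNIV. ?g j)"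
    unfolding inner_mdeg lweight_def
    by (simp add: of_rat_sum of_rat_mult left_diff_distrib sum_subtractf)
  have nn: "?g j \<ge> 0" for j
  proof -
    have "u \<bullet> rcol A j \<le> real_of_rat (L j)"
      using assms unfolding supports_def by (metis less_eq_real_def)
    then show ?thesis by simp
  qed
  show "u \<bullet> (\<chi> i. real_of_int (mdeg A m $ i)) \<le> real_of_rat (lweight L m)"
    using eq sum_nonneg[of UNIV ?g] nn by simp
  have "(\<Sum>j\<in>UNIV. ?g j) = 0 \<longleftrightarrow> (\<forall>j. ?g j = 0)"
    using nn by (subst sum_nonneg_eq_0_iff) auto
  also have "\<dots> \<longleftrightarrow> supp m \<subseteq> \<tau>"
  proof -
    have "?g j = 0 \<longleftrightarrow> (coef m j \<noteq> 0 \<longrightarrow> j \<in> \<tau>)" for j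
      using assms unfolding supports_def by (cases "j \<in> \<tau>") (auto dest: spec[of _ j])
    then show ?thesis by (auto simp: in_keys_iff subset_iff)
  qed
  finally show "u \<bullet> (\<chi> i. real_of_int (mdeg A m $ i)) = real_of_rat (lweight L m) \<longleftrightarrow> supp m \<subseteq> \<tau>"
    using eq by auto
qed

lemma grL_subset_I_tau:
  assumes u: "supports A L \<tau> u"
  shows "grL L (toric_ideal A) \<subseteq> I_tau A \<tau>"
  unfolding grL_def
proof (rule gen_ideal_least[OF is_ideal_I_tau], clarify)
  fix f assume "f \<in> toric_ideal A"
  then have f: "deg_sum A UNIV b f = 0" for b using toric_ideal_subset I_tau_iff by blast
  let ?M = "Max (lweight L ` supp f)"
  have "deg_sum A \<tau> b (init_form L f) = 0" for b
  proof -
    let ?w = "u \<bullet> (\<chi> i. real_of_int (b $ i))"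
    have sub: "supp (init_form L f) \<subseteq> supp f" by (auto simp: in_keys_iff coef_init_form)
    have d: "deg_sum A \<tau> b (init_form L f) =
        (\<Sum>m\<in>supp f. if supp m \<subseteq> \<tau> \<and> mdeg A m = b \<and> lweight L m = ?M then coef f m else 0)"
      unfolding deg_sum_superset[OF finite_keys sub]
        by (rule sum.cong) (auto simp: coef_init_form)
    \<comment> \<open>If \<open>?w\<close> equals the top weight, then \<open>?w\<close> bounds the
      weights in degree \<open>b\<close> from below and \<open>?M\<close> from above, so all terms
      of \<open>f\<close> of this degree survive and lie on \<tau>; their sum is 0 because
      \<open>f\<close> is toric. Otherwise no surviving term of degree \<open>b\<close> lies on
      \<tau>.\<close>
    show ?thesis
    proof (cases "?w = real_of_rat ?M")
      case True
      have "supp m \<subseteq> \<tau> \<and> lweight L m = ?M"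
        if "m \<in> supp f" "mdeg A m = b" for m
      proof -
        have "lweight L m \<le> ?M" using that by simp
        moreover have "real_of_rat ?M \<le> real_of_rat (lweight L m)"
          using lweight_ge(1)[OF u, of m] that True by simp
        ultimately have "lweight L m = ?M" by (simp add: of_rat_less_eq)
        then show ?thesis using lweight_ge(2)[OF u, of m] that True by simp
      qed
      then have "deg_sum A \<tau> b (init_form L f) = (\<Sum>m\<in>supp f. if mdeg A m = b then coef f m else 0)"
        unfolding d by (intro sum.cong) auto
      also have "\<dots> = deg_sum A UNIV b f" by (simp add: deg_sum_superset[of "supp f"])
      finally show ?thesis using f by simp
    next
      case False
      then have "\<not> (supp m \<subseteq> \<tau> \<and> mdeg A m = b \<and> lweight L m = ?M)" for m
        using lweight_ge(2)[OF u, of m] by auto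
      then show ?thesis unfolding d by (intro sum.neutral) auto
    qed
  qed
  then show "init_form L f \<in> I_tau A \<tau>" by (simp add: I_tau_iff)
qed

section \<open>Monomials modulo a prime ideal\<close>

lemma mono_prod: "mono (m :: 'n::finite \<Rightarrow>\<^sub>0 nat) = (\<Prod>j\<in>UNIV. mono (Poly_Mapping.single j 1) ^ coef m j)"
proof -
  have p: "mono (Poly_Mapping.single j k) = mono (Poly_Mapping.single j 1) ^ k" for j and k :: nat
  proof (induction k)
    case 0 then show ?case by (simp add: mono_0)
  next
    case (Suc k)
    have "Poly_Mapping.single j (Suc k) = Poly_Mapping.single j 1 + Poly_Mapping.single j k"
      by (simp flip: single_add)
    then show ?case by (simp add: mono_add Suc)
  qed
  have s: "mono (\<Sum>j\<in>S. g j) = (\<Prod>j\<in>S. mono (g j))" for g :: "_ \<Rightarrow> 'n \<Rightarrow>\<^sub>0 nat" and S :: "'n set"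
    by (induction S rule: infinite_finite_induct) (auto simp: mono_0 mono_add)
  have "mono m = (\<Prod>j\<in>UNIV. mono (Poly_Mapping.single j (coef m j)))"
    by (subst exponent_sum_single[of m]) (rule s)
  also have "\<dots> = (\<Prod>j\<in>UNIV. mono (Poly_Mapping.single j 1) ^ coef m j)"
    by (rule prod.cong[OF refl]) (rule p)
  finally show ?thesis .
qed

text \<open>The candidate for \<tau>: these variables become units once the nonzero classes modulo
  \<open>P\<close> are inverted. For the prime of a point it is the support of the point.\<close>

definition unit_vars :: "'n::finite mpoly set \<Rightarrow> 'n set" where
  "unit_vars P = {j. mono (Poly_Mapping.single j 1) \<notin> P}"

lemma is_prime_idealD:
  assumes "is_prime_ideal P"
  shows "is_ideal P" "1 \<notin> P" "x * y \<in> P \<Longrightarrow> x \<in> P \<or> y \<in> P"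
  using assms by (auto simp: is_prime_ideal_def)

lemma is_idealD:
  assumes "is_ideal I"
  shows "0 \<in> I" "x \<in> I \<Longrightarrow> y \<in> I \<Longrightarrow> x + y \<in> I" "x \<in> I \<Longrightarrow> r * x \<in> I"
    "x \<in> I \<Longrightarrow> y \<in> I \<Longrightarrow> x - y \<in> I"
proof -
  show "0 \<in> I" "x \<in> I \<Longrightarrow> y \<in> I \<Longrightarrow> x + y \<in> I" "x \<in> I \<Longrightarrow> r * x \<in> I"
    using assms by (auto simp: is_ideal_def)
  show "x - y \<in> I" if "x \<in> I" "y \<in> I"
  proof -
    have "x + (- 1) * y \<in> I" using assms that unfolding is_ideal_def by blast
    then show ?thesis by simp
  qed
qed

lemma is_ideal_sum: "is_ideal I \<Longrightarrow> (\<And>i. i \<in> S \<Longrightarrow> f i \<in> I) \<Longrightarrow> (\<Sum>i\<in>S. f i) \<in> I"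
  by (induction S rule: infinite_finite_induct) (auto intro: is_idealD)

lemma prime_ideal_prod:
  assumes P: "is_prime_ideal P" and "(\<Prod>i\<in>S. f i) \<in> P"
  shows "\<exists>i\<in>S. f i \<in> P"
  using assms(2)
proof (induction S rule: infinite_finite_induct)
  case (insert i S)
  then have "f i * prod f S \<in> P" by simp
  then show ?case using insert is_prime_idealD(3)[OF P] by blast
qed (use is_prime_idealD(2)[OF P] in auto)

lemma prime_ideal_power: "is_prime_ideal P \<Longrightarrow> x ^ k \<in> P \<Longrightarrow> x \<in> P"
proof (induction k)
  case 0
  then show ?case using is_prime_idealD(2) by auto
next
  case (Suc k)
  then show ?case using is_prime_idealD(3)[of P x "x ^ k"] by auto
qed

lemma mono_in_prime_iff:
  assumes P: "is_prime_ideal P"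
  shows "mono m \<in> P \<longleftrightarrow> \<not> supp m \<subseteq> unit_vars P"
proof
  assume "mono m \<in> P"
  then obtain j where j: "mono (Poly_Mapping.single j 1) ^ coef m j \<in> P"
    using prime_ideal_prod[OF P, of "\<lambda>j. mono (Poly_Mapping.single j 1) ^ coef m j" UNIV]
    unfolding mono_prod[of m] by blast
  then have "coef m j \<noteq> 0" using is_prime_idealD(2)[OF P] by (metis power_0)
  moreover have "mono (Poly_Mapping.single j 1) \<in> P" using prime_ideal_power[OF P j] .
  ultimately show "\<not> supp m \<subseteq> unit_vars P" 
    unfolding unit_vars_def by (metis (mono_tags, lifting) in_keys_iff mem_Collect_eq subsetD)
next
  assume "\<not> supp m \<subseteq> unit_vars P"
  then obtain j where j: "mono (Poly_Mapping.single j 1) \<in> P" "coef m j \<noteq> 0"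
    by (auto simp: unit_vars_def in_keys_iff)
  have "m = (m - Poly_Mapping.single j 1) + Poly_Mapping.single j 1"
    using j(2) by (intro poly_mapping_eqI) (auto simp: lookup_add lookup_minus lookup_single when_def)
  then have "mono m = mono (m - Poly_Mapping.single j 1) * mono (Poly_Mapping.single j 1)"
    by (simp only: flip: mono_add)
  then show "mono m \<in> P"
    using is_idealD(3)[OF is_prime_idealD(1)[OF P] j(1)] by simp
qed

section \<open>Primes containing the initial ideal\<close>

text \<open>Vectors are plain functions over a general ring because the duality is needed over the
  rationals, where certificates can be scaled to integer relations.\<close>

definition dot :: "('i::finite \<Rightarrow> 'a::comm_ring) \<Rightarrow> ('i \<Rightarrow> 'a) \<Rightarrow> 'a" where
  "dot a x = (\<Sum>i\<in>UNIV. a i * x i)"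

lemma dot_diff_left: "dot (\<lambda>i. a i - t * b i) x = dot a x - t * dot b x"
  by (simp add: dot_def algebra_simps sum_subtractf sum_distrib_left)

lemma dot_diff_right: "dot a (\<lambda>i. x i - t * y i) = dot a x - t * dot a y"
  by (simp add: dot_def algebra_simps sum_subtractf sum_distrib_left)

lemma dot_scale_right: "dot a (\<lambda>i. t * y i) = t * dot a y"
  by (simp add: dot_def algebra_simps sum_distrib_left)

lemma dot_sum_right: "dot a (\<lambda>i. \<Sum>k\<in>S. y k i) = (\<Sum>k\<in>S. dot a (y k))"
  unfolding dot_def by (simp add: sum_distrib_left) (rule sum.swap)

text \<open>Bartl's induction: if the last inequality is needed, project along a vector \<open>z\<close> witnessing
  this onto the kernel of the last functional.\<close>

lemma farkas:
  fixes c :: "'k \<Rightarrow> 'i::finite \<Rightarrow> 'a::linordered_field"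
  assumes "finite S" "\<And>x. (\<forall>k\<in>S. dot (c k) x \<le> 0) \<Longrightarrow> dot b x \<le> 0"
  shows "\<exists>l. (\<forall>k\<in>S. l k \<ge> 0) \<and> (\<forall>i. b i = (\<Sum>k\<in>S. l k * c k i))"
  using assms
proof (induction S arbitrary: b c rule: finite_induct)
  case empty
  \<comment> \<open>Without constraints the hypothesis may be tested at \<open>b\<close> itself,
    where it bounds a sum of squares by 0.\<close>
  have "dot b b \<le> 0" using empty by simp
  moreover have "(\<Sum>i\<in>UNIV. b i * b i) \<ge> 0" by (intro sum_nonneg) auto
  ultimately have "(\<Sum>i\<in>UNIV. b i * b i) = 0" unfolding dot_def by simp
  then have "\<forall>i. b i * b i = 0" by (subst (asm) sum_nonneg_eq_0_iff) auto
  then show ?case by simp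
next
  case (insert s S)
  show ?case
  proof (cases "\<forall>x. (\<forall>k\<in>S. dot (c k) x \<le> 0) \<longrightarrow> dot b x \<le> 0")
    case True
    then obtain l where l: "\<forall>k\<in>S. l k \<ge> 0" "\<forall>i. b i = (\<Sum>k\<in>S. l k * c k i)"
      using insert.IH[of c b] by blast
    have "(\<Sum>k\<in>insert s S. (l(s := 0)) k * c k i) = (\<Sum>k\<in>S. l k * c k i)" for i
      using insert.hyps by (simp, intro sum.cong) auto
    with l show ?thesis by (intro exI[of _ "l(s := 0)"]) auto
  next
    case False
    then obtain y where y: "\<forall>k\<in>S. dot (c k) y \<le> 0" "dot b y > 0"
      by (auto simp: not_le)
    have sy: "dot (c s) y > 0" using insert.prems[of y] y by (auto simp: not_le[symmetric])
    define z where "z = (\<lambda>i. inverse (dot (c s) y) * y i)"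
    have z: "dot (c s) z = 1" "\<forall>k\<in>S. dot (c k) z \<le> 0" "dot b z > 0"
      using sy y by (auto simp: z_def dot_scale_right mult_le_0_iff)
    define c' where "c' k = (\<lambda>i. c k i - dot (c k) z * c s i)" for k
    define b' where "b' = (\<lambda>i. b i - dot b z * c s i)"
    have "dot b' x \<le> 0" if x: "\<forall>k\<in>S. dot (c' k) x \<le> 0" for x
    proof -
      let ?x = "\<lambda>i. x i - dot (c s) x * z i"
      have "\<forall>k\<in>insert s S. dot (c k) ?x \<le> 0"
        using x z(1) unfolding dot_diff_right c'_def dot_diff_left by (simp add: mult.commute)
      then have "dot b ?x \<le> 0" by (rule insert.prems)
      then show ?thesis unfolding dot_diff_right b'_def dot_diff_left by (simp add: mult.commute)
    qed
    then obtain l where l: "\<forall>k\<in>S. l k \<ge> 0" "\<forall>i. b' i = (\<Sum>k\<in>S. l k * c' k i)"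
      using insert.IH[of c' b'] by blast
    \<comment> \<open>The multiplier of \<open>c s\<close> that remains after the projection is
      undone.\<close>
    define t where "t = dot b z - (\<Sum>k\<in>S. l k * dot (c k) z)"
    have "(\<Sum>k\<in>S. l k * dot (c k) z) \<le> 0"
      using l(1) z(2) by (intro sum_nonpos) (auto simp: mult_nonneg_nonpos)
    then have "t \<ge> 0" using z(3) by (simp add: t_def)
    moreover have "b i = (\<Sum>k\<in>insert s S. (l(s := t)) k * c k i)" for i
    proof -
      have "b i = b' i + dot b z * c s i" by (simp add: b'_def)
      also have "b' i = (\<Sum>k\<in>S. l k * c k i) - (\<Sum>k\<in>S. l k * dot (c k) z) * c s i"
        using l(2) by (simp add: c'_def algebra_simps sum_subtractf sum_distrib_left)
      finally have "b i = t * c s i + (\<Sum>k\<in>S. l k * c k i)"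
        by (simp add: t_def algebra_simps)
      also have "(\<Sum>k\<in>S. l k * c k i) = (\<Sum>k\<in>S. (l(s := t)) k * c k i)"
        using insert.hyps by (intro sum.cong) auto
      finally show ?thesis using insert.hyps by simp
    qed
    ultimately show ?thesis using l(1) by (intro exI[of _ "l(s := t)"]) auto
  qed
qed

text \<open>For each \<open>g\<close> outside \<tau>, Farkas yields a solution of the weak system
  that is strict at \<open>g\<close>; the sum of these solutions is strict at every such index at
  once.\<close>

lemma motzkin_transposition:
  fixes r :: "'k::finite \<Rightarrow> 'i::finite \<Rightarrow> 'a::linordered_field"
  assumes no_cert: "\<And>v. (\<forall>k. k \<notin> \<tau> \<longrightarrow> v k \<ge> 0) \<Longrightarrow> (\<forall>i. (\<Sum>k\<in>UNIV. v k * r k i) = 0)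
             \<Longrightarrow> (\<forall>k. k \<notin> \<tau> \<longrightarrow> v k = 0)"
  shows "\<exists>x. (\<forall>k\<in>\<tau>. dot (r k) x = 0) \<and> (\<forall>k. k \<notin> \<tau> \<longrightarrow> dot (r k) x > 0)"
proof -
  have "\<exists>x. (\<forall>k\<in>\<tau>. dot (r k) x = 0) \<and> (\<forall>k. dot (r k) x \<ge> 0) \<and> dot (r g) x > 0" if g: "g \<notin> \<tau>" for g
  proof (rule ccontr)
    assume neg: "\<not> ?thesis"
    \<comment> \<open>The \<open>Inl\<close> rows say that all values are nonnegative, the
      \<open>Inr\<close> rows that those on \<tau> are also nonpositive, which encodes the
      equations.\<close>
    define c where "c = case_sum (\<lambda>k i. - r k i) r"
    define S where "S = range (Inl :: 'k \<Rightarrow> 'k + 'k) \<union> Inr ` \<tau>"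
    have "dot (r g) x \<le> 0" if x: "\<forall>k\<in>S. dot (c k) x \<le> 0" for x
    proof -
      have "dot (r k) x \<ge> 0" for k
        using x[rule_format, of "Inl k"] by (simp add: S_def c_def dot_def sum_negf)
      moreover have "dot (r k) x \<le> 0" if "k \<in> \<tau>" for k
        using x[rule_format, of "Inr k"] that by (simp add: S_def c_def)
      ultimately show ?thesis using neg by (meson leI order_antisym)
    qed
    then obtain l where l: "\<forall>k\<in>S. l k \<ge> 0" "\<forall>i. r g i = (\<Sum>k\<in>S. l k * c k i)"
      using farkas[of S c "r g"] by (auto simp: S_def)
    \<comment> \<open>The Farkas identity for \<open>r g\<close> with all terms moved to one side.
      The extra 1 makes \<open>v g\<close> positive, against \<open>no_cert\<close>.\<close>
    define v where "v k = l (Inl k) - (if k \<in> \<tau> then l (Inr k) else 0) + (if k = g then 1 else 0)" for k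
    have v1: "(\<Sum>k\<in>UNIV. v k * r k i) = 0" for i
    proof -
      have "r g i = (\<Sum>k\<in>UNIV. l (Inl k) * - r k i) + (\<Sum>k\<in>\<tau>. l (Inr k) * r k i)"
        unfolding l(2)[rule_format] S_def
        by (subst sum.union_disjoint) (auto simp: sum.reindex c_def)
      also have "(\<Sum>k\<in>\<tau>. l (Inr k) * r k i) = (\<Sum>k\<in>UNIV. (if k \<in> \<tau> then l (Inr k) else 0) * r k i)"
        by (rule sum.mono_neutral_cong_left) auto
      finally have "r g i = (\<Sum>k\<in>UNIV. l (Inl k) * - r k i) + (\<Sum>k\<in>UNIV. (if k \<in> \<tau> then l (Inr k) else 0) * r k i)" .
      moreover have "r g i = (\<Sum>k\<in>UNIV. (if k = g then 1 else 0) * r k i)"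
        by (simp add: if_distrib[of "\<lambda>t. t * _"] cong: if_cong)
      ultimately show ?thesis
        unfolding v_def distrib_right left_diff_distrib sum.distrib sum_subtractf
        by (simp add: sum_negf)
    qed
    have v2: "v k \<ge> 0" if "k \<notin> \<tau>" for k
      using l(1)[rule_format, of "Inl k"] that by (simp add: v_def S_def)
    have v3: "v g > 0" using l(1)[rule_format, of "Inl g"] g by (simp add: v_def S_def)
    have "\<forall>k. k \<notin> \<tau> \<longrightarrow> v k = 0"
      by (rule no_cert) (use v1 v2 in blast)+
    then show False using g v3 by simp
  qed
  then obtain X where X: "\<And>g k. g \<notin> \<tau> \<Longrightarrow> k \<in> \<tau> \<Longrightarrow> dot (r k) (X g) = 0"
      "\<And>g k. g \<notin> \<tau> \<Longrightarrow> dot (r k) (X g) \<ge> 0" "\<And>g. g \<notin> \<tau> \<Longrightarrow> dot (r g) (X g) > 0"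
    by metis
  let ?x = "\<lambda>i. \<Sum>g\<in>-\<tau>. X g i"
  have "dot (r k) ?x = 0" if "k \<in> \<tau>" for k
    unfolding dot_sum_right using X(1) that by (intro sum.neutral) auto
  moreover have "dot (r k) ?x > 0" if "k \<notin> \<tau>" for k
    unfolding dot_sum_right using X(2,3) that by (intro sum_pos2[of _ k]) auto
  ultimately show ?thesis by blast
qed

lemma clear_denominators:
  fixes v :: "'n::finite \<Rightarrow> rat"
  shows "\<exists>N::int. N > 0 \<and> (\<exists>w. \<forall>j. of_int N * v j = of_int (w j))"
proof -
  define q where "q j = snd (quotient_of (v j))" for j
  define p where "p j = fst (quotient_of (v j))" for j
  have q: "q j > 0" for j unfolding q_def by (rule quotient_of_denom_pos') 
  have v: "v j = of_int (p j) / of_int (q j)" for j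
    unfolding p_def q_def by (rule quotient_of_div) simp
  have "of_int (prod q UNIV) * v j = of_int (prod q (UNIV - {j}) * p j)" for j
    using q[of j] by (simp add: v prod.remove[of UNIV j])
  moreover have "prod q UNIV > 0" using q by (simp add: prod_pos)
  ultimately show ?thesis
    by (intro exI[of _ "prod q UNIV"] conjI exI[of _ "\<lambda>j. prod q (UNIV - {j}) * p j"]) auto
qed

text \<open>Transposition for the system \<open>L j * s - y . A j\<close> zero on \<tau>, positive
  off \<tau>, and \<open>s > 0\<close>; then \<open>u = y / s\<close>. A rational certificate scales
  to an integer relation, and its nonnegative multiplier of \<open>s > 0\<close> is what makes the
  weight of that relation nonpositive.\<close>

lemma supports_if_no_certificate:
  fixes A :: "'n::finite \<Rightarrow> int^'d::finite"
  assumes no_cert: "\<And>v. (\<forall>j. j \<notin> \<tau> \<longrightarrow> v j \<ge> 0) \<Longrightarrow> (\<Sum>j\<in>UNIV. v j *s A j) = 0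
     \<Longrightarrow> (\<Sum>j\<in>UNIV. L j * of_int (v j)) \<le> 0
     \<Longrightarrow> (\<Sum>j\<in>UNIV. L j * of_int (v j)) = 0 \<and> (\<forall>j. j \<notin> \<tau> \<longrightarrow> v j = 0)"
  shows "\<exists>u. supports A L \<tau> u"
proof -
  \<comment> \<open>The index \<open>None\<close> carries the variable and the inequality that homogenise the system.\<close>
  define r :: "'n option \<Rightarrow> 'd option \<Rightarrow> rat" where
    "r k i = (case k of None \<Rightarrow> (case i of None \<Rightarrow> 1 | Some _ \<Rightarrow> 0)
       | Some j \<Rightarrow> (case i of None \<Rightarrow> L j | Some i \<Rightarrow> - of_int (A j $ i)))" for k i
  have opt: "(\<Sum>k\<in>UNIV. g k) = g None + (\<Sum>j\<in>UNIV. g (Some j))" for g :: "'z::finite option \<Rightarrow> rat"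
    by (simp add: UNIV_option_conv sum.reindex)
  have "\<exists>x. (\<forall>k\<in>Some ` \<tau>. dot (r k) x = 0) \<and> (\<forall>k. k \<notin> Some ` \<tau> \<longrightarrow> dot (r k) x > 0)"
  proof (rule motzkin_transposition)
    fix v assume v: "\<forall>k. k \<notin> Some ` \<tau> \<longrightarrow> v k \<ge> 0" "\<forall>i. (\<Sum>k\<in>UNIV. v k * r k i) = 0"
    obtain N w where N: "N > 0" and w: "\<And>j. of_int N * v (Some j) = of_int (w j)"
      using clear_denominators[of "\<lambda>j. v (Some j)"] by metis
    have w0: "w j \<ge> 0" if "j \<notin> \<tau>" for j
    proof -
      have "v (Some j) \<ge> 0" using v(1) that by auto
      then have "of_int N * v (Some j) \<ge> 0" using N by simp
      then show ?thesis unfolding w by simp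
    qed
    have vL: "v None + (\<Sum>j\<in>UNIV. v (Some j) * L j) = 0"
      using v(2)[rule_format, of None] by (simp add: opt r_def)
    have wL: "(\<Sum>j\<in>UNIV. L j * of_int (w j)) = of_int N * - v None"
      using vL by (simp add: w[symmetric] sum_distrib_left mult_ac add_eq_0_iff2 flip: sum_negf)
    have wA: "(\<Sum>j\<in>UNIV. w j *s A j) = 0"
    proof (rule vec_eq_iff[THEN iffD2], rule allI)
      fix i
      have "(\<Sum>j\<in>UNIV. v (Some j) * of_int (A j $ i)) = 0"
        using v(2)[rule_format, of "Some i"] by (simp add: opt r_def sum_negf)
      then have "of_int N * (\<Sum>j\<in>UNIV. v (Some j) * of_int (A j $ i)) = 0" by simp
      then have "(\<Sum>j\<in>UNIV. of_int (w j) * of_int (A j $ i)) = (0::rat)"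
        by (simp add: w[symmetric] sum_distrib_left mult_ac)
      then have "of_int (\<Sum>j\<in>UNIV. w j * A j $ i) = (0::rat)" by simp
      then show "(\<Sum>j\<in>UNIV. w j *s A j) $ i = 0 $ i" unfolding of_int_eq_0_iff by simp
    qed
    have v0: "v None \<ge> 0" using v(1) by auto
    have "(\<Sum>j\<in>UNIV. L j * of_int (w j)) \<le> 0"
      unfolding wL using N v0 by (simp add: mult_le_0_iff)
    from no_cert[OF _ wA this] w0
    have *: "(\<Sum>j\<in>UNIV. L j * of_int (w j)) = 0" "\<forall>j. j \<notin> \<tau> \<longrightarrow> w j = 0"
      by blast+
    have "v None = 0" using *(1) N unfolding wL by simp
    moreover have "v (Some j) = 0" if "j \<notin> \<tau>" for j using *(2) w[of j] N that by simp
    ultimately show "\<forall>k. k \<notin> Some ` \<tau> \<longrightarrow> v k = 0"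
      by (metis image_eqI not_Some_eq)
  qed
  then obtain x where x: "\<And>j. j \<in> \<tau> \<Longrightarrow> dot (r (Some j)) x = 0"
      "\<And>j. j \<notin> \<tau> \<Longrightarrow> dot (r (Some j)) x > 0" "dot (r None) x > 0"
        by (auto; blast)
  have s: "x None > 0" using x(3) by (simp add: dot_def opt r_def)
  define y where "y i = x (Some i) / x None" for i
  have d: "dot (r (Some j)) x = x None * (L j - (\<Sum>i\<in>UNIV. y i * of_int (A j $ i)))" for j
    using s by (simp add: dot_def opt r_def y_def right_diff_distrib sum_distrib_left sum_negf mult_ac)
  define u :: "real^'d" where "u = (\<chi> i. real_of_rat (y i))"
  have u: "u \<bullet> rcol A j = real_of_rat (\<Sum>i\<in>UNIV. y i * of_int (A j $ i))" for j
    by (simp add: u_def rcol_def inner_vec_def of_rat_sum of_rat_mult)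
  have "supports A L \<tau> u"
    using x(1,2) s unfolding supports_def u d by (auto simp: of_rat_less zero_less_mult_iff)
  then show ?thesis by blast
qed

section \<open>Reconstructing a prime from its variables\<close>

text \<open>A certificate \<open>v\<close> has its negative part on \<tau>, so that monomial avoids
  \<open>P\<close>. Were it the heavier one, it would be an initial form and lie in
  \<open>P\<close>. Hence the weights agree, the binomial lies in \<open>P\<close>, and the positive
  monomial avoids \<open>P\<close> too, which confines \<open>v\<close> to \<tau>.\<close>

lemma prime_over_grL_supports:
  assumes P: "is_prime_ideal P" and J: "grL L (toric_ideal A) \<subseteq> P"
  shows "\<exists>u. supports A L (unit_vars P) u"
proof (rule supports_if_no_certificate)
  let ?\<tau> = "unit_vars P"
  fix v assume v: "\<forall>j. j \<notin> ?\<tau> \<longrightarrow> v j \<ge> 0" "(\<Sum>j\<in>UNIV. v j *s A j) = 0"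
    "(\<Sum>j\<in>UNIV. L j * of_int (v j)) \<le> 0"
  have "coef (neg_part v) j = 0"
    if "j \<notin> ?\<tau>" for j using v(1) that by (simp add: coef_neg_part)
  then have "supp (neg_part v) \<subseteq> ?\<tau>" by (auto simp: in_keys_iff)
  then have neg: "mono (neg_part v) \<notin> P" using mono_in_prime_iff[OF P] by blast
  have deg: "mdeg A (pos_part v) = mdeg A (neg_part v)"
    using mdeg_pos_neg_part[of A v] v(2) by simp
  have "\<not> lweight L (pos_part v) < lweight L (neg_part v)"
    using mono_in_grL[OF deg[symmetric]] neg J by blast
  then have 0: "(\<Sum>j\<in>UNIV. L j * of_int (v j)) = 0"
    using lweight_pos_neg_part[of L v] v(3) by simp
  then have "lweight L (pos_part v) = lweight L (neg_part v)"
    using lweight_pos_neg_part[of L v] by simp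
  then have "mono (pos_part v) - mono (neg_part v) \<in> P"
    using binomial_in_grL[OF deg] J by blast
  then have "mono (pos_part v) \<notin> P"
    using neg is_idealD(4)[OF is_prime_idealD(1)[OF P], of "mono (pos_part v)" "mono (pos_part v) - mono (neg_part v)"]
    by auto
  then have "supp (pos_part v) \<subseteq> ?\<tau>" using mono_in_prime_iff[OF P] by blast
  then have "v j = 0" if "j \<notin> ?\<tau>" for j
    using v(1) that by (force simp: in_keys_iff subset_iff coef_pos_part)
  with 0 show "(\<Sum>j\<in>UNIV. L j * of_int (v j)) = 0 \<and> (\<forall>j. j \<notin> ?\<tau> \<longrightarrow> v j = 0)" by blast
qed

text \<open>On \<tau> the weight is \<open>u\<close> applied to the degree, so equal degrees force
  equal weights.\<close>

lemma binomial_on_cell_in_grL: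
  assumes u: "supports A L \<tau> u" and "supp m \<subseteq> \<tau>" "supp m' \<subseteq> \<tau>" "mdeg A m = mdeg A m'"
  shows "mono m - mono m' \<in> grL L (toric_ideal A)"
proof (rule binomial_in_grL)
  show "lweight L m = lweight L m'"
    using lweight_ge(2)[OF u, of m] lweight_ge(2)[OF u, of m'] assms by simp
qed fact

text \<open>Terms involving a variable outside \<open>unit_vars P\<close> vanish modulo
  \<open>P\<close>, and the remaining monomials of this degree are all congruent to
  \<open>mono m\<close>.\<close>

lemma homogeneous_mod_prime:
  assumes P: "is_prime_ideal P" and J: "grL L (toric_ideal A) \<subseteq> P"
    and m: "supp m \<subseteq> unit_vars P"
  shows "hom_comp A (mdeg A m) f - Poly_Mapping.single 0 (deg_sum A (unit_vars P) (mdeg A m) f) * mono m \<in> P"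
proof -
  let ?\<tau> = "unit_vars P" and ?b = "mdeg A m"
  let ?t = "\<lambda>k. Poly_Mapping.single k (coef f k)"
  obtain u where u: "supports A L ?\<tau> u" using prime_over_grL_supports[OF P J] by blast
  have I: "is_ideal P" using is_prime_idealD[OF P] by blast
  have single: "Poly_Mapping.single k c = Poly_Mapping.single 0 c * mono k" for k and c :: complex
    by (simp add: mono_def mult_single)
  define S where "S = {k \<in> supp f. mdeg A k = ?b}"
  define T where "T = {k \<in> S. supp k \<subseteq> ?\<tau>}"
  have fin: "finite S" "T \<subseteq> S" by (auto simp: S_def T_def)
  have "hom_comp A ?b f = (\<Sum>k\<in>S - T. ?t k) + (\<Sum>k\<in>T. ?t k)"
    unfolding hom_comp_def S_def[symmetric] using sum.subset_diff[OF fin(2,1)] .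
  moreover have "Poly_Mapping.single 0 (deg_sum A ?\<tau> ?b f) * mono m
      = (\<Sum>k\<in>T. Poly_Mapping.single 0 (coef f k) * mono m)"
  proof -
    have "deg_sum A ?\<tau> ?b f = (\<Sum>k\<in>T. coef f k)"
      unfolding deg_sum_def T_def S_def by (rule sum.cong) auto
    moreover have "Poly_Mapping.single (0 :: 'a \<Rightarrow>\<^sub>0 nat) (\<Sum>k\<in>T. coef f k) = (\<Sum>k\<in>T. Poly_Mapping.single 0 (coef f k))"
      by (induction T rule: infinite_finite_induct) (auto simp: single_add)
    ultimately show ?thesis by (simp add: sum_distrib_right)
  qed
  ultimately have eq: "hom_comp A ?b f - Poly_Mapping.single 0 (deg_sum A ?\<tau> ?b f) * mono m
      = (\<Sum>k\<in>S - T. ?t k) + (\<Sum>k\<in>T. Poly_Mapping.single 0 (coef f k) * (mono k - mono m))"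
    by (simp add: right_diff_distrib sum_subtractf flip: single)
  have "(\<Sum>k\<in>S - T. ?t k) \<in> P"
  proof (rule is_ideal_sum[OF I])
    fix k assume "k \<in> S - T"
    then have "mono k \<in> P" using mono_in_prime_iff[OF P] by (auto simp: T_def)
    then show "?t k \<in> P" unfolding single[of k] by (rule is_idealD(3)[OF I])
  qed
  moreover have "(\<Sum>k\<in>T. Poly_Mapping.single 0 (coef f k) * (mono k - mono m)) \<in> P"
  proof (rule is_ideal_sum[OF I])
    fix k assume "k \<in> T"
    then have "mono k - mono m \<in> P"
      using binomial_on_cell_in_grL[OF u _ m, of k] J by (auto simp: T_def S_def)
    then show "Poly_Mapping.single 0 (coef f k) * (mono k - mono m) \<in> P"
      by (rule is_idealD(3)[OF I])
  qed
  ultimately show ?thesis unfolding eq by (rule is_idealD(2)[OF I])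
qed

lemma hom_comp_sum: "f = (\<Sum>b\<in>mdeg A ` supp f. hom_comp A b f)"
  by (rule poly_mapping_eqI) (auto simp: lookup_sum coef_hom_comp in_keys_iff)

lemma graded_prime_eq_I_tau:
  assumes P: "is_prime_ideal P" and gr: "is_graded A P" and J: "grL L (toric_ideal A) \<subseteq> P"
  shows "P = I_tau A (unit_vars P)"
proof -
  let ?\<tau> = "unit_vars P"
  have I: "is_ideal P" using is_prime_idealD[OF P] by blast
  \<comment> \<open>In a degree reached by no monomial on \<tau>, every monomial lies in
    \<open>P\<close> and the coefficient sum is empty.\<close>
  have no_mon: "hom_comp A b f \<in> P \<and> deg_sum A ?\<tau> b f = 0"
    if "\<nexists>m. supp m \<subseteq> ?\<tau> \<and> mdeg A m = b" for b f
  proof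
    show "deg_sum A ?\<tau> b f = 0"
      unfolding deg_sum_def using that by (intro sum.neutral) auto
    show "hom_comp A b f \<in> P"
      unfolding hom_comp_def
    proof (rule is_ideal_sum[OF I])
      fix k assume k: "k \<in> {m \<in> supp f. mdeg A m = b}"
      then have "mono k \<in> P" using mono_in_prime_iff[OF P] that by auto
      then have "Poly_Mapping.single 0 (coef f k) * mono k \<in> P" by (rule is_idealD(3)[OF I])
      then show "Poly_Mapping.single k (coef f k) \<in> P" by (simp add: mono_def mult_single)
    qed
  qed
  show ?thesis
  proof (intro set_eqI iffI)
    fix f assume f: "f \<in> P"
    have "deg_sum A ?\<tau> b f = 0" for b
    proof (cases "\<exists>m. supp m \<subseteq> ?\<tau> \<and> mdeg A m = b")
      case True
      then obtain m where m: "supp m \<subseteq> ?\<tau>" "mdeg A m = b" by blast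
      let ?c = "deg_sum A ?\<tau> b f"
      have "hom_comp A b f \<in> P" using gr f by (auto simp: is_graded_def)
      then have c: "Poly_Mapping.single 0 ?c * mono m \<in> P"
        using is_idealD(4)[OF I _ homogeneous_mod_prime[OF P J m(1), of f]] m(2) by force
      show ?thesis
      proof (rule ccontr)
        assume "?c \<noteq> 0"
        \<comment> \<open>A nonzero scalar is invertible, so \<open>mono m\<close> itself would lie
          in \<open>P\<close>.\<close>
        then have "mono m = Poly_Mapping.single 0 (inverse ?c) * (Poly_Mapping.single 0 ?c * mono m)"
          by (simp add: mono_def mult_single)
        then have "mono m \<in> P" using is_idealD(3)[OF I c] by metis
        then show False using mono_in_prime_iff[OF P] m(1) by blast
      qed
    qed (use no_mon in blast)
    then show "f \<in> I_tau A ?\<tau>" by (simp add: I_tau_iff)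
  next
    fix f assume "f \<in> I_tau A ?\<tau>"
    then have f: "deg_sum A ?\<tau> b f = 0" for b by (simp add: I_tau_iff)
    have "hom_comp A b f \<in> P" for b
    proof (cases "\<exists>m. supp m \<subseteq> ?\<tau> \<and> mdeg A m = b")
      case True
      then show ?thesis using homogeneous_mod_prime[OF P J, of _ f] f by force
    qed (use no_mon in blast)
    then show "f \<in> P" by (subst hom_comp_sum[of f A]) (rule is_ideal_sum[OF I])
  qed
qed

lemma graded_primes_over_grL:
  "{P. is_prime_ideal P \<and> is_graded A P \<and> grL L (toric_ideal A) \<subseteq> P}
    = I_tau A ` {\<tau>. \<exists>u. supports A L \<tau> u}"
proof (intro equalityI subsetI)
  fix P assume "P \<in> {P. is_prime_ideal P \<and> is_graded A P \<and> grL L (toric_ideal A) \<subseteq> P}"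
  then show "P \<in> I_tau A ` {\<tau>. \<exists>u. supports A L \<tau> u}"
    using graded_prime_eq_I_tau[of P A L] prime_over_grL_supports[of P L A]
    by (intro image_eqI[of _ _ "unit_vars P"]) simp_all
next
  fix P assume "P \<in> I_tau A ` {\<tau>. \<exists>u. supports A L \<tau> u}"
  then obtain \<tau> u where "P = I_tau A \<tau>" "supports A L \<tau> u" by blast
  then show "P \<in> {P. is_prime_ideal P \<and> is_graded A P \<and> grL L (toric_ideal A) \<subseteq> P}"
    by (simp add: grL_subset_I_tau is_prime_ideal_I_tau is_graded_I_tau)
qed

section \<open>Torus orbits in the zero set\<close>

text \<open>The values \<open>\<zeta>\<close> on the family \<open>g\<close> extend to a character of the lattice generated by \<open>g\<close>.\<close>

definition consistent :: "('i \<Rightarrow> int^'d::finite) \<Rightarrow> ('i \<Rightarrow> complex) \<Rightarrow> 'i set \<Rightarrow> bool" where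
  "consistent g \<zeta> S \<longleftrightarrow> (\<forall>i\<in>S. \<zeta> i \<noteq> 0) \<and>
     (\<forall>v. (\<Sum>i\<in>S. v i *s g i) = 0 \<longrightarrow> (\<Prod>i\<in>S. \<zeta> i powi v i) = 1)"

lemma sum_smult_linear:
  fixes g :: "'i \<Rightarrow> int^'d::finite"
  shows "(\<Sum>i\<in>S. (v i + a * w i) *s g i) = (\<Sum>i\<in>S. v i *s g i) + a *s (\<Sum>i\<in>S. w i *s g i)"
  by (simp add: vec_eq_iff distrib_right sum.distrib sum_distrib_left mult.assoc)

lemma ex_complex_root: "n > 0 \<Longrightarrow> w \<noteq> 0 \<Longrightarrow> \<exists>z::complex. z \<noteq> 0 \<and> z ^ n = w"
  by (rule exI[of _ "exp (ln w / of_nat n)"]) (simp flip: exp_of_nat_mult)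

text \<open>Division with remainder by the least positive element; \<open>n = 0\<close> stands for
  the zero subgroup.\<close>

lemma int_subgroup_cyclic:
  fixes K :: "int set"
  assumes "0 \<in> K" and lin: "\<And>k l a. k \<in> K \<Longrightarrow> l \<in> K \<Longrightarrow> k + a * l \<in> K"
  shows "\<exists>n::nat. int n \<in> K \<and> (\<forall>k\<in>K. int n dvd k)"
proof (cases "\<exists>k\<in>K. k \<noteq> 0")
  case False
  then show ?thesis using assms(1) by (intro exI[of _ 0]) auto
next
  case True
  then obtain k where k: "k \<in> K" "k \<noteq> 0" by blast
  have "- k \<in> K" using lin[OF assms(1) k(1), of "-1"] by simp
  then have "\<exists>n::nat. n > 0 \<and> int n \<in> K"
    using k by (intro exI[of _ "nat \<bar>k\<bar>"]) (auto simp: abs_if)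
  then obtain n where n: "n > 0" "int n \<in> K" and min: "\<And>m. m < n \<Longrightarrow> \<not> (m > 0 \<and> int m \<in> K)"
    using exists_least_iff[of "\<lambda>n. n > 0 \<and> int n \<in> K"] by auto
  have "int n dvd l" if l: "l \<in> K" for l
  proof -
    have "l mod int n = l + (- (l div int n)) * int n"
      by (simp add: minus_div_mult_eq_mod [symmetric])
    then have "l mod int n \<in> K" using lin[OF l n(2)] by metis
    moreover have "nat (l mod int n) < n" using n(1) by (auto simp: nat_less_iff)
    ultimately have "\<not> 0 < l mod int n" using min[of "nat (l mod int n)"] by auto
    moreover have "0 \<le> l mod int n" using n(1) by simp
    ultimately have "l mod int n = 0" by linarith
    then show ?thesis by (simp add: dvd_eq_mod_eq_0)
  qed
  with n show ?thesis by blast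
qed

text \<open>The multiples of \<open>g x\<close> lying in the lattice of \<open>S\<close> are those
  by multiples of some \<open>n\<close>. The value at \<open>n\<close> times \<open>g x\<close> is
  already prescribed, and \<open>z\<close> is an \<open>n\<close>-th root of it.\<close>

lemma consistent_extend:
  fixes g :: "'i \<Rightarrow> int^'d::finite"
  assumes S: "finite S" "x \<notin> S" and c: "consistent g \<zeta> S"
  shows "\<exists>z. consistent g (\<zeta>(x := z)) (insert x S)"
proof -
  let ?c = "\<lambda>v. \<Sum>i\<in>S. v i *s g i"
  have nz: "\<zeta> i \<noteq> 0" if "i \<in> S" for i using c that by (auto simp: consistent_def)
  define K where "K = {k::int. \<exists>v. k *s g x = ?c v}"
  have "\<exists>n::nat. int n \<in> K \<and> (\<forall>k\<in>K. int n dvd k)"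
  proof (rule int_subgroup_cyclic)
    show "0 \<in> K" unfolding K_def by (auto intro!: exI[of _ "\<lambda>_. 0"])
    fix k l a assume "k \<in> K" "l \<in> K"
    then obtain v w where "k *s g x = ?c v" "l *s g x = ?c w" by (auto simp: K_def)
    then have "(k + a * l) *s g x = ?c (\<lambda>i. v i + a * w i)"
      unfolding sum_smult_linear by (simp add: vector_sadd_rdistrib flip: vector_smult_assoc)
    then show "k + a * l \<in> K" unfolding K_def by (intro CollectI exI)
  qed
  then obtain n w where n: "int n *s g x = ?c w" "\<And>k. k \<in> K \<Longrightarrow> int n dvd k" unfolding K_def by blast
  \<comment> \<open>For \<open>n = 0\<close> the coefficients \<open>w\<close> form a relation, so
    the prescribed value is 1 and \<open>z = 1\<close> serves.\<close>
  have "\<exists>z. z \<noteq> 0 \<and> z ^ n = (\<Prod>i\<in>S. \<zeta> i powi w i)"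
  proof (cases "n = 0")
    case True
    then have "?c w = 0" using n(1) by simp
    then have "(\<Prod>i\<in>S. \<zeta> i powi w i) = 1" using c by (auto simp: consistent_def)
    then show ?thesis using True by (intro exI[of _ 1]) auto
  next
    case False
    then show ?thesis using nz S(1) by (intro ex_complex_root) auto
  qed
  then obtain z where z: "z \<noteq> 0" "z ^ n = (\<Prod>i\<in>S. \<zeta> i powi w i)" by blast
  have "consistent g (\<zeta>(x := z)) (insert x S)"
    unfolding consistent_def
  proof (intro conjI allI impI)
    show "\<forall>i\<in>insert x S. (\<zeta>(x := z)) i \<noteq> 0" using nz z by auto
    fix v assume "(\<Sum>i\<in>insert x S. v i *s g i) = 0"
    then have v: "v x *s g x + ?c v = 0" using S by simp
    then have "v x *s g x = ?c (\<lambda>i. 0 + (-1) * v i)"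
      unfolding sum_smult_linear by (simp add: add_eq_0_iff2 vector_smult_lneg)
    then have "v x \<in> K" unfolding K_def by (intro CollectI exI)
    then obtain l where l: "v x = int n * l" using n(2) by blast
    \<comment> \<open>Substituting \<open>w\<close> for \<open>n\<close> times \<open>g x\<close>
      turns the relation \<open>v\<close> into one on \<open>S\<close> alone, where consistency
      applies.\<close>
    have "?c (\<lambda>i. v i + l * w i) = ?c v + v x *s g x"
      unfolding sum_smult_linear n(1)[symmetric] l by (simp add: vector_smult_assoc mult.commute)
    then have "(\<Prod>i\<in>S. \<zeta> i powi (v i + l * w i)) = 1"
      using c v by (simp add: consistent_def add.commute)
    moreover have "(\<Prod>i\<in>S. \<zeta> i powi (v i + l * w i)) = (\<Prod>i\<in>S. \<zeta> i powi v i * (\<zeta> i powi w i) powi l)"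
      by (rule prod.cong) (auto simp: power_int_add nz power_int_mult mult.commute[of l])
    moreover have "\<dots> = (\<Prod>i\<in>S. \<zeta> i powi v i) * (z ^ n) powi l"
      unfolding z(2) prod.distrib
    proof -
      have "(\<Prod>i\<in>S. (\<zeta> i powi w i) powi l) = (\<Prod>i\<in>S. \<zeta> i powi w i) powi l"
        using S(1) by (induction S) (auto simp: power_int_mult_distrib)
      then show "(\<Prod>i\<in>S. \<zeta> i powi v i) * (\<Prod>i\<in>S. (\<zeta> i powi w i) powi l) =
          (\<Prod>i\<in>S. \<zeta> i powi v i) * (\<Prod>i\<in>S. \<zeta> i powi w i) powi l" by simp
    qed
    moreover have "(z ^ n) powi l = z powi v x"
      by (simp add: l power_int_mult)
    moreover have "(\<Prod>i\<in>S. (\<zeta>(x := z)) i powi v i) = (\<Prod>i\<in>S. \<zeta> i powi v i)"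
      using S by (intro prod.cong) auto
    ultimately show "(\<Prod>i\<in>insert x S. (\<zeta>(x := z)) i powi v i) = 1"
      using S by (simp add: mult.commute)
  qed
  then show ?thesis by blast
qed

lemma consistent_extend_finite:
  fixes g :: "'i \<Rightarrow> int^'d::finite"
  assumes "finite T" "finite S" "S \<inter> T = {}" and c: "consistent g \<zeta> S"
  shows "\<exists>\<zeta>'. (\<forall>i\<in>S. \<zeta>' i = \<zeta> i) \<and> consistent g \<zeta>' (S \<union> T)"
  using assms(1,3)
proof (induction T)
  case empty
  then show ?case using c by auto
next
  case (insert x T)
  then obtain \<zeta>' where \<zeta>': "\<forall>i\<in>S. \<zeta>' i = \<zeta> i" "consistent g \<zeta>' (S \<union> T)" by auto
  obtain z where "consistent g (\<zeta>'(x := z)) (insert x (S \<union> T))"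
    using consistent_extend[OF _ _ \<zeta>'(2), of x] insert assms(2) by auto
  moreover have "\<forall>i\<in>S. (\<zeta>'(x := z)) i = \<zeta> i"
    using \<zeta>'(1) insert.prems by auto
  ultimately show ?case unfolding Un_insert_right by blast
qed

section \<open>Evaluation at points and torus characters\<close>

definition torus_char :: "complex^'d::finite \<Rightarrow> int^'d \<Rightarrow> complex" where
  "torus_char \<eta> b = (\<Prod>i\<in>UNIV. (\<eta> $ i) powi (b $ i))"

text \<open>The standard basis vectors are adjoined to the columns in \<tau>; the extended values on
  them are the coordinates of \<eta>.\<close>

lemma ex_torus_point:
  fixes A :: "'n::finite \<Rightarrow> int^'d::finite" and \<xi> :: "complex^'n"
  assumes c: "consistent A (\<lambda>j. \<xi> $ j) \<tau>"
  shows "\<exists>\<eta>. (\<forall>i. \<eta> $ i \<noteq> 0) \<and> (\<forall>j\<in>\<tau>. torus_char \<eta> (A j) = \<xi> $ j)"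
proof -
  define g :: "'n + 'd \<Rightarrow> int^'d" where "g = case_sum A (\<lambda>i. axis i 1)"
  define \<zeta> :: "'n + 'd \<Rightarrow> complex" where "\<zeta> = case_sum (\<lambda>j. \<xi> $ j) (\<lambda>_. 1)"
  have "consistent g \<zeta> (Inl ` \<tau>)"
    using c by (simp add: consistent_def g_def \<zeta>_def sum.reindex prod.reindex)
  then obtain \<zeta>' where \<zeta>': "\<forall>i\<in>Inl ` \<tau>. \<zeta>' i = \<zeta> i" "consistent g \<zeta>' (Inl ` \<tau> \<union> range Inr)"
    using consistent_extend_finite[of "range Inr" "Inl ` \<tau>" g \<zeta>] by auto
  define \<eta> :: "complex^'d" where "\<eta> = (\<chi> i. \<zeta>' (Inr i))"
  have "torus_char \<eta> (A j) = \<xi> $ j" if j: "j \<in> \<tau>" for j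
  proof -
    \<comment> \<open>The relation expressing \<open>A j\<close> in the standard basis.\<close>
    define v :: "'n + 'd \<Rightarrow> int" where "v = case_sum (\<lambda>k. if k = j then -1 else 0) (\<lambda>i. A j $ i)"
    have ax: "(\<Sum>i\<in>UNIV. A j $ i *s axis i 1) = A j"
      by (simp add: vec_eq_iff axis_def if_distrib[of "\<lambda>t. _ * t"] cong: if_cong)
    have "(\<Sum>i\<in>Inl ` \<tau> \<union> range Inr. v i *s g i)
        = (\<Sum>k\<in>\<tau>. (if k = j then -1 else 0) *s A k) + (\<Sum>i\<in>UNIV. A j $ i *s axis i 1)"
      by (subst sum.union_disjoint) (auto simp: sum.reindex v_def g_def)
    also have "(\<Sum>k\<in>\<tau>. (if k = j then -1 else 0) *s A k) = (\<Sum>k\<in>\<tau>. if k = j then - A j else 0)"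
      by (rule sum.cong) (auto simp: vec_eq_iff)
    finally have "(\<Sum>i\<in>Inl ` \<tau> \<union> range Inr. v i *s g i) = 0"
      using j by (simp add: ax)
    then have "(\<Prod>i\<in>Inl ` \<tau> \<union> range Inr. \<zeta>' i powi v i) = 1"
      using \<zeta>'(2) by (auto simp: consistent_def)
    moreover have "(\<Prod>i\<in>Inl ` \<tau> \<union> range Inr. \<zeta>' i powi v i)
        = (\<Prod>k\<in>\<tau>. (\<xi> $ k) powi (if k = j then -1 else 0)) * torus_char \<eta> (A j)"
      using \<zeta>'(1) by (subst prod.union_disjoint)
        (auto simp: prod.reindex v_def \<zeta>_def torus_char_def \<eta>_def)
    moreover have "(\<Prod>k\<in>\<tau>. (\<xi> $ k) powi (if k = j then -1 else 0)) = (\<Prod>k\<in>\<tau>. if k = j then inverse (\<xi> $ j) else 1)"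
      by (rule prod.cong) auto
    moreover have "\<xi> $ j \<noteq> 0" using c j by (auto simp: consistent_def)
    ultimately show ?thesis using j by (simp add: field_simps)
  qed
  moreover have "\<eta> $ i \<noteq> 0" for i
    using \<zeta>'(2) by (auto simp: consistent_def \<eta>_def)
  ultimately show ?thesis by blast
qed

definition monom_eval :: "complex^'n::finite \<Rightarrow> ('n \<Rightarrow>\<^sub>0 nat) \<Rightarrow> complex" where
  "monom_eval \<xi> m = (\<Prod>j\<in>UNIV. (\<xi> $ j) ^ coef m j)"

lemma peval_eq: "peval f \<xi> = lin_ext (\<lambda>c. c) (monom_eval \<xi>) f"
  by (simp add: peval_def lin_ext_def monom_eval_def)

lemma peval_hom: "monoid_ring_hom (\<lambda>c. c) (monom_eval \<xi>)"
  by unfold_locales (auto simp: monom_eval_def lookup_add power_add prod.distrib)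

lemma peval_mono: "peval (mono m) \<xi> = monom_eval \<xi> m"
  by (simp add: peval_eq mono_def monoid_ring_hom.lin_ext_single[OF peval_hom])

lemma peval_diff: "peval (f - g) \<xi> = peval f \<xi> - peval g \<xi>"
  by (simp add: peval_eq monoid_ring_hom.lin_ext_diff[OF peval_hom])

text \<open>This lets the results on primes that assume no grading apply to points of the zero
  set.\<close>

lemma is_prime_ideal_point: "is_prime_ideal {f. peval f \<xi> = 0}"
  unfolding peval_eq by (rule monoid_ring_hom.is_prime_ideal_kernel[OF peval_hom]) simp

lemma unit_vars_point: "unit_vars {f. peval f \<xi> = 0} = {j. \<xi> $ j \<noteq> 0}"
proof -
  have "monom_eval \<xi> (Poly_Mapping.single j 1) = \<xi> $ j" for j
  proof -
    have "monom_eval \<xi> (Poly_Mapping.single j 1) = (\<Prod>k\<in>UNIV. if k = j then \<xi> $ j else 1)"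
      unfolding monom_eval_def by (rule prod.cong) (auto simp: lookup_single when_def)
    then show ?thesis by simp
  qed
  then show ?thesis by (simp add: unit_vars_def peval_mono)
qed

lemma torus_char_add:
  assumes "\<forall>i. \<eta> $ i \<noteq> 0"
  shows "torus_char \<eta> (a + b) = torus_char \<eta> a * torus_char \<eta> b"
  using assms by (simp add: torus_char_def power_int_add prod.distrib)

lemma torus_char_0: "torus_char \<eta> 0 = 1"
  by (simp add: torus_char_def)

lemma torus_char_mdeg:
  fixes A :: "'n::finite \<Rightarrow> int^'d::finite"
  assumes \<eta>: "\<forall>i. \<eta> $ i \<noteq> 0"
  shows "torus_char \<eta> (mdeg A m) = (\<Prod>j\<in>UNIV. torus_char \<eta> (A j) ^ coef m j)"
proof -
  have "torus_char \<eta> (int k *s a) = torus_char \<eta> a ^ k" for k a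
    by (induction k) (auto simp: torus_char_0 torus_char_add[OF \<eta>] vector_sadd_rdistrib)
  moreover have "torus_char \<eta> (\<Sum>j\<in>S. g j) = (\<Prod>j\<in>S. torus_char \<eta> (g j))" for g and S :: "'n set"
    by (induction S rule: infinite_finite_induct) (auto simp: torus_char_0 torus_char_add[OF \<eta>])
  ultimately show ?thesis unfolding mdeg_def by simp
qed

lemma orbit_eq:
  "orbit A \<tau> = {(\<chi> j. if j \<in> \<tau> then torus_char \<eta> (A j) else 0) | \<eta>. \<forall>i. \<eta> $ i \<noteq> 0}"
proof -
  have "(\<chi> j. torus_char \<eta> (A j) * (if j \<in> \<tau> then 1 else 0)) = (\<chi> j. if j \<in> \<tau> then torus_char \<eta> (A j) else 0)" for \<eta>
    by (simp add: vec_eq_iff)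
  then show ?thesis unfolding orbit_def by (simp flip: torus_char_def)
qed

text \<open>Evaluation at an orbit point factors through \<open>laurent_map\<close>, so everything
  in \<open>I_tau A \<tau>\<close> vanishes on the orbit.\<close>

lemma peval_orbit:
  assumes \<eta>: "\<forall>i. \<eta> $ i \<noteq> 0"
  shows "peval f (\<chi> j. if j \<in> \<tau> then torus_char \<eta> (A j) else 0)
    = lin_ext (\<lambda>c. c) (torus_char \<eta>) (laurent_map A \<tau> f)" (is "peval f ?\<xi> = _")
proof -
  let ?ev = "lin_ext (\<lambda>c. c) (torus_char \<eta>)"
  interpret ev: monoid_ring_hom "\<lambda>c. c" "torus_char \<eta>"
    by unfold_locales (auto simp: torus_char_0 torus_char_add[OF \<eta>])
  have "?ev (tau_char A \<tau> m) = monom_eval ?\<xi> m" for m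
  proof (cases "supp m \<subseteq> \<tau>")
    case True
    then have "coef m j = 0" if "j \<notin> \<tau>" for j
      using that by (auto simp: subset_iff in_keys_iff)
    then have "monom_eval ?\<xi> m = (\<Prod>j\<in>UNIV. torus_char \<eta> (A j) ^ coef m j)"
      unfolding monom_eval_def by (intro prod.cong) auto
    then show ?thesis
      using True by (simp add: tau_char_def ev.lin_ext_single torus_char_mdeg[OF \<eta>])
  next
    case False
    then obtain j where "coef m j \<noteq> 0" "j \<notin> \<tau>" by (auto simp: in_keys_iff)
    then have "monom_eval ?\<xi> m = 0"
      unfolding monom_eval_def by (auto intro!: bexI[of _ j])
    then show ?thesis using False by (simp add: tau_char_def ev.lin_ext_0)
  qed
  then show ?thesis
    unfolding laurent_map_eq lin_ext_def[of "Poly_Mapping.single 0"]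
    by (simp add: ev.lin_ext_sum ev.lin_ext_mult ev.lin_ext_single torus_char_0)
      (simp add: peval_def monom_eval_def)
qed

lemma orbit_subset_zero_set:
  assumes "supports A L \<tau> u"
  shows "orbit A \<tau> \<subseteq> zero_set (grL L (toric_ideal A))"
proof -
  have "laurent_map A \<tau> f = 0" if "f \<in> grL L (toric_ideal A)" for f
    using grL_subset_I_tau[OF assms] that by (auto simp: I_tau_def)
  then show ?thesis by (auto simp: orbit_eq zero_set_def peval_orbit lin_ext_def)
qed

lemma zero_set_grL:
  fixes A :: "'n::finite \<Rightarrow> int^'d::finite"
  shows "zero_set (grL L (toric_ideal A)) = (\<Union>\<tau>\<in>{\<tau>. \<exists>u. supports A L \<tau> u}. orbit A \<tau>)"
proof (intro equalityI subsetI)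
  fix \<xi> assume \<xi>: "\<xi> \<in> zero_set (grL L (toric_ideal A))"
  define \<tau> where "\<tau> = {j. \<xi> $ j \<noteq> 0}"
  have J: "grL L (toric_ideal A) \<subseteq> {f. peval f \<xi> = 0}"
    using \<xi> by (auto simp: zero_set_def)
  obtain u where u: "supports A L \<tau> u"
    using prime_over_grL_supports[OF is_prime_ideal_point J]
      unfolding unit_vars_point \<tau>_def by blast
  have "consistent A (\<lambda>j. \<xi> $ j) \<tau>"
    unfolding consistent_def
  proof (intro conjI allI impI)
    show "\<forall>j\<in>\<tau>. \<xi> $ j \<noteq> 0" by (simp add: \<tau>_def)
    fix v assume v: "(\<Sum>j\<in>\<tau>. v j *s A j) = 0"
    \<comment> \<open>Extended by zero, the relation has positive and negative parts supported on
      \<tau>.\<close>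
    define w where "w j = (if j \<in> \<tau> then v j else 0)" for j
    have "(\<Sum>j\<in>UNIV. w j *s A j) = (\<Sum>j\<in>\<tau>. v j *s A j)"
      by (rule sum.mono_neutral_cong_right) (auto simp: w_def)
    then have deg: "mdeg A (pos_part w) = mdeg A (neg_part w)"
      using mdeg_pos_neg_part[of A w] v by simp
    have "supp (pos_part w) \<subseteq> \<tau>" "supp (neg_part w) \<subseteq> \<tau>"
      by (auto simp: in_keys_iff coef_pos_part coef_neg_part w_def split: if_splits)
    then have "mono (pos_part w) - mono (neg_part w) \<in> grL L (toric_ideal A)"
      by (rule binomial_on_cell_in_grL[OF u _ _ deg])
    then have eq: "monom_eval \<xi> (pos_part w) = monom_eval \<xi> (neg_part w)"
      using J by (auto simp: peval_diff peval_mono)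
    have nz: "monom_eval \<xi> (neg_part w) \<noteq> 0"
      by (auto simp: monom_eval_def coef_neg_part w_def \<tau>_def)
    have "(\<Prod>j\<in>\<tau>. (\<xi> $ j) powi v j) = (\<Prod>j\<in>UNIV. (\<xi> $ j) powi w j)"
      by (rule prod.mono_neutral_cong_left) (auto simp: w_def)
    also have "\<dots> = (\<Prod>j\<in>UNIV. (\<xi> $ j) ^ nat (w j) / (\<xi> $ j) ^ nat (- w j))"
      by (rule prod.cong) (auto simp: power_int_def field_simps)
    also have "\<dots> = monom_eval \<xi> (pos_part w) / monom_eval \<xi> (neg_part w)"
      by (simp add: monom_eval_def coef_pos_part coef_neg_part prod_dividef)
    finally show "(\<Prod>j\<in>\<tau>. (\<xi> $ j) powi v j) = 1" using eq nz by simp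
  qed
  then obtain \<eta> where \<eta>: "\<forall>i. \<eta> $ i \<noteq> 0" "\<forall>j\<in>\<tau>. torus_char \<eta> (A j) = \<xi> $ j"
    using ex_torus_point by blast
  have "\<xi> = (\<chi> j. if j \<in> \<tau> then torus_char \<eta> (A j) else 0)"
    using \<eta>(2) by (auto simp: vec_eq_iff \<tau>_def)
  then have "\<xi> \<in> orbit A \<tau>" unfolding orbit_eq using \<eta>(1) by blast
  then show "\<xi> \<in> (\<Union>\<tau>\<in>{\<tau>. \<exists>u. supports A L \<tau> u}. orbit A \<tau>)" using u by blast
qed (use orbit_subset_zero_set in blast)

lemma orbit_support:
  assumes "\<xi> \<in> orbit A \<tau>"
  shows "\<tau> = {j. \<xi> $ j \<noteq> 0}"
  using assms by (auto simp: orbit_eq torus_char_def split: if_splits)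

text \<open>The nonzero coordinates of a point recover \<tau>.\<close>

lemma disjoint_orbits: "disjoint_family_on (orbit A) X"
  unfolding disjoint_family_on_def using orbit_support by blast

section \<open>Faces of the polyhedron and orbit closures\<close>

lemma closed_zero_set: "closed (zero_set I)"
proof -
  have "continuous_on UNIV (peval f)" for f :: "'a mpoly"
    unfolding peval_def by (intro continuous_intros)
  then have "closed {\<xi>. peval f \<xi> = 0}" for f :: "'a mpoly"
    by (intro closed_Collect_eq) (auto intro: continuous_intros)
  then have "closed (\<Inter>f\<in>I. {\<xi>. peval f \<xi> = 0})" by blast
  moreover have "zero_set I = (\<Inter>f\<in>I. {\<xi>. peval f \<xi> = 0})"
    by (auto simp: zero_set_def)
  ultimately show ?thesis by simp
qed

lemma orbit_subset_closure:
  assumes u: "supports A L \<tau> u" and u': "supports A L \<tau>' u'" and sub: "\<tau> \<subseteq> \<tau>'"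
  shows "orbit A \<tau> \<subseteq> closure (orbit A \<tau>')"
proof
  fix \<xi> assume "\<xi> \<in> orbit A \<tau>"
  then obtain \<eta> where \<eta>: "\<forall>i. \<eta> $ i \<noteq> 0"
    and \<xi>: "\<xi> = (\<chi> j. if j \<in> \<tau> then torus_char \<eta> (A j) else 0)"
      by (auto simp: orbit_eq)
  define w where "w = u' - u"
  have w0: "w \<bullet> rcol A j = 0" if "j \<in> \<tau>" for j
    using u u' sub that by (auto simp: supports_def w_def inner_diff_left)
  have wpos: "w \<bullet> rcol A j > 0" if "j \<in> \<tau>'" "j \<notin> \<tau>" for j
    using u u' that by (auto simp: supports_def w_def inner_diff_left)
  \<comment> \<open>As \<open>w\<close> is only a real vector, the one-parameter group is
    exponential rather than given by integer powers. Coordinates on \<tau> stay fixed and those on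
    the rest of \<open>\<tau>'\<close> decay.\<close>
  define \<theta> :: "nat \<Rightarrow> complex^_" where "\<theta> n = (\<chi> i. \<eta> $ i * of_real (exp (- (real n * w $ i))))" for n
  have \<theta>: "\<forall>i. \<theta> n $ i \<noteq> 0" for n
    using \<eta> by (simp add: \<theta>_def)
  have char: "torus_char (\<theta> n) (A j) = torus_char \<eta> (A j) * of_real (exp (- (real n * (w \<bullet> rcol A j))))" for n j
  proof -
    have "torus_char (\<theta> n) (A j) = torus_char \<eta> (A j) * of_real (\<Prod>i\<in>UNIV. exp (- (real n * w $ i)) powi (A j $ i))"
      by (simp add: torus_char_def \<theta>_def power_int_mult_distrib prod.distrib of_real_power_int)
    also have "(\<Prod>i\<in>UNIV. exp (- (real n * w $ i)) powi (A j $ i)) = (\<Prod>i\<in>UNIV. exp (- (real n * w $ i) * of_int (A j $ i)))"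
      by (simp add: exp_power_int mult_ac)
    also have "\<dots> = exp (- (real n * (w \<bullet> rcol A j)))"
      by (simp add: exp_sum[symmetric] inner_vec_def rcol_def sum_distrib_left sum_negf mult_ac)
    finally show ?thesis .
  qed
  define X where "X n = (\<chi> j. if j \<in> \<tau>' then torus_char (\<theta> n) (A j) else 0)" for n
  have "X n \<in> orbit A \<tau>'" for n using \<theta>[of n] by (auto simp: orbit_eq X_def)
  moreover have "X \<longlonglongrightarrow> \<xi>"
  proof (rule vec_tendstoI)
    fix j
    show "(\<lambda>n. X n $ j) \<longlonglongrightarrow> \<xi> $ j"
    proof (cases "j \<in> \<tau>' \<and> j \<notin> \<tau>")
      case False
      then have "(\<lambda>n. X n $ j) = (\<lambda>n. \<xi> $ j)"
        using sub w0 by (auto simp: X_def \<xi> char)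
      then show ?thesis by simp
    next
      case True
      let ?c = "w \<bullet> rcol A j"
      have "(\<lambda>n. exp (- ?c) ^ n) \<longlonglongrightarrow> 0"
        using wpos True by (intro LIMSEQ_power_zero) auto
      then have "(\<lambda>n. exp (- (real n * ?c))) \<longlonglongrightarrow> 0"
        by (simp flip: exp_of_nat_mult)
      then have "(\<lambda>n. complex_of_real (exp (- (real n * ?c)))) \<longlonglongrightarrow> of_real 0" by (rule tendsto_of_real)
      from tendsto_mult_left[OF this, of "torus_char \<eta> (A j)"]
      show ?thesis using True by (simp add: X_def \<xi> char)
    qed
  qed
  ultimately show "\<xi> \<in> closure (orbit A \<tau>')" unfolding closure_sequential by blast
qed

section \<open>Maximal supported sets span\<close>

lemma full_inner_eq_0:
  fixes A :: "'n::finite \<Rightarrow> int^'d::finite"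
  assumes "is_full A" "\<And>j. w \<bullet> rcol A j = 0"
  shows "w = 0"
proof -
  have "w $ i = 0" for i
  proof -
    obtain c where c: "axis i 1 = (\<Sum>j\<in>UNIV. c j *s A j)"
      using assms(1) unfolding is_full_def by blast
    have "axis i 1 = (\<Sum>j\<in>UNIV. real_of_int (c j) *\<^sub>R rcol A j)"
    proof (rule vec_eq_iff[THEN iffD2], rule allI)
      fix k
      have "real_of_int ((axis i 1 :: int^'d) $ k) = real_of_int ((\<Sum>j\<in>UNIV. c j *s A j) $ k)"
        by (simp only: c)
      then show "axis i 1 $ k = (\<Sum>j\<in>UNIV. real_of_int (c j) *\<^sub>R rcol A j) $ k"
        by (simp add: rcol_def axis_def split: if_splits)
    qed
    then have "w \<bullet> axis i 1 = 0" using assms(2) by (simp add: inner_sum_right)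
    then show ?thesis by (simp add: inner_axis)
  qed
  then show ?thesis by (simp add: vec_eq_iff)
qed

text \<open>Moving \<open>u\<close> along \<open>w\<close> keeps \<tau> tight. The least ratio
  \<open>q j\<close> over the columns where \<open>w\<close> is positive is the first moment a new
  column becomes tight; the other columns only gain slack or keep it.\<close>

lemma ex_larger_support:
  fixes A :: "'n::finite \<Rightarrow> int^'d::finite"
  assumes u: "supports A L \<tau> u" and w0: "\<And>j. j \<in> \<tau> \<Longrightarrow> w \<bullet> rcol A j = 0" and k: "w \<bullet> rcol A k > 0"
  shows "\<exists>\<tau>' u'. \<tau> \<subset> \<tau>' \<and> supports A L \<tau>' u'"
proof -
  define q where "q j = (real_of_rat (L j) - u \<bullet> rcol A j) / (w \<bullet> rcol A j)" for j
  define B where "B = {j. w \<bullet> rcol A j > 0}"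
  have B: "finite (q ` B)" "q ` B \<noteq> {}" using k by (auto simp: B_def)
  define t where "t = Min (q ` B)"
  have t_le: "t \<le> q j" if "j \<in> B" for j using B(1) that unfolding t_def by simp
  obtain b where b: "b \<in> B" "q b = t" using Min_in[OF B] unfolding t_def by auto
  have le: "u \<bullet> rcol A j \<le> real_of_rat (L j)" for j
    using u unfolding supports_def by (metis less_eq_real_def)
  have "b \<notin> \<tau>" using b(1) w0 by (auto simp: B_def)
  have t0: "t \<ge> 0" using b le[of b] by (auto simp: q_def B_def)
  define u' where "u' = u + t *\<^sub>R w"
  have u': "u' \<bullet> rcol A j = u \<bullet> rcol A j + t * (w \<bullet> rcol A j)" for j
    by (simp add: u'_def inner_add_left)
  have le': "u' \<bullet> rcol A j \<le> real_of_rat (L j)" for j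
  proof (cases "j \<in> B")
    case True
    then show ?thesis using t_le[OF True] by (simp add: u' q_def B_def pos_le_divide_eq)
  next
    case False
    then have "t * (w \<bullet> rcol A j) \<le> 0" using t0 by (auto simp: B_def mult_le_0_iff)
    then show ?thesis using le[of j] by (simp add: u')
  qed
  define \<tau>' where "\<tau>' = {j. u' \<bullet> rcol A j = real_of_rat (L j)}"
  have "supports A L \<tau>' u'" using le' by (auto simp: supports_def \<tau>'_def less_le)
  moreover have "b \<in> \<tau>'" using b by (auto simp: \<tau>'_def u' q_def B_def field_simps)
  moreover have "\<tau> \<subseteq> \<tau>'"
    using u w0 by (auto simp: \<tau>'_def u' supports_def)
  ultimately show ?thesis using \<open>b \<notin> \<tau>\<close> by blast
qed

text \<open>A maximal \<tau>' that did not span would have a nonzero normal \<open>w\<close>. By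
  fullness some column is not orthogonal to \<open>w\<close>, and \<open>w\<close> or
  \<open>- w\<close> then enlarges \<tau>'.\<close>

lemma ex_spanning_support:
  fixes A :: "'n::finite \<Rightarrow> int^'d::finite"
  assumes full: "is_full A" and "supports A L \<tau> u"
  shows "\<exists>\<tau>' u'. \<tau> \<subseteq> \<tau>' \<and> supports A L \<tau>' u' \<and> span (rcol A ` \<tau>') = UNIV"
proof -
  let ?C = "{\<tau>. \<exists>u. supports A L \<tau> u}"
  have "\<tau> \<in> ?C" using assms(2) by blast
  from finite_has_maximal2[OF finite this]
  obtain \<tau>' where \<tau>': "\<tau>' \<in> ?C" "\<tau> \<subseteq> \<tau>'"
    and max: "\<forall>\<sigma>\<in>?C. \<tau>' \<subseteq> \<sigma> \<longrightarrow> \<tau>' = \<sigma>"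
    by (elim bexE conjE)
  obtain u' where u': "supports A L \<tau>' u'" using \<tau>'(1) by blast
  have no: False if "\<And>j. j \<in> \<tau>' \<Longrightarrow> w \<bullet> rcol A j = 0" "w \<bullet> rcol A k > 0" for w k
    using ex_larger_support[OF u' that] max by blast
  have "span (rcol A ` \<tau>') = UNIV"
  proof (rule ccontr)
    assume "span (rcol A ` \<tau>') \<noteq> UNIV"
    then obtain w where w: "w \<noteq> 0" "span (rcol A ` \<tau>') \<subseteq> {x. w \<bullet> x = 0}"
      using span_not_univ_subset_hyperplane by blast
    then have w0: "w \<bullet> rcol A j = 0"
      if "j \<in> \<tau>'" for j using span_base that by blast
    obtain k where "w \<bullet> rcol A k \<noteq> 0" using full_inner_eq_0[OF full] w(1) by blast
    then show False using no[of w k] no[of "- w" k] w0 by force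
  qed
  with \<tau>' u' show ?thesis by blast
qed

section \<open>Faces away from the origin as supported sets\<close>

lemma
  fixes A :: "'n::finite \<Rightarrow> int^'d::finite" and L :: "'n \<Rightarrow> rat"
    and h :: "int^'d" and \<epsilon> :: rat
  assumes eps_pos: "\<epsilon> > 0"
    and eps_small: "\<forall>j. of_int (lin_form h (A j)) > \<epsilon> * \<bar>L j\<bar>"
  shows umbrella_eq: "umbrella A L h \<epsilon> = {\<tau>. \<exists>u. supports A L \<tau> u}"
    and umbrella_dim_spanning: "supports A L \<tau> u \<Longrightarrow> span (rcol A ` \<tau>) = UNIV
           \<Longrightarrow> \<tau> \<in> umbrella_dim A L h \<epsilon> (int CARD('d) - 1)"
proof -
  define H :: "real^'d" where "H = (\<chi> i. real_of_int (h $ i))"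
  define D where "D j = real_of_rat \<epsilon> * real_of_rat (L j) + H \<bullet> rcol A j" for j
  let ?o = "origin_pt h \<epsilon>" and ?q = "col_pt A L h \<epsilon>" and ?P = "AL_polyhedron A L h \<epsilon>"
  have e: "real_of_rat \<epsilon> > 0" using eps_pos by simp
  have D: "D j > 0" for j
  proof -
    have "real_of_rat (\<epsilon> * \<bar>L j\<bar>) < real_of_rat (of_int (lin_form h (A j)))"
      using eps_small by (simp only: of_rat_less)
    moreover have "real_of_rat (of_int (lin_form h (A j))) = H \<bullet> rcol A j"
      by (simp add: lin_form_def H_def rcol_def inner_vec_def of_rat_sum of_rat_mult)
    moreover have "- (\<epsilon> * \<bar>L j\<bar>) \<le> \<epsilon> * L j"
      using eps_pos mult_left_mono[of "- \<bar>L j\<bar>" "L j" \<epsilon>] by simp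
    then have "real_of_rat (- (\<epsilon> * \<bar>L j\<bar>)) \<le> real_of_rat (\<epsilon> * L j)" by (simp only: of_rat_less_eq)
    ultimately show ?thesis by (simp add: D_def of_rat_minus of_rat_mult)
  qed
  have o: "?o = (1 / real_of_rat \<epsilon>) *\<^sub>R (1, 0)"
    by (simp add: origin_pt_def aff_pt_def)
  have q: "?q j = (1 / D j) *\<^sub>R (real_of_rat (L j), rcol A j)" for j
    by (simp add: col_pt_def aff_pt_def D_def H_def rcol_def inner_vec_def)
  \<comment> \<open>This functional is 1 on the whole polyhedron, so affine conditions there can be
    rewritten as linear ones.\<close>
  define N where "N = (real_of_rat \<epsilon>, H)"
  have No: "N \<bullet> ?o = 1" using e by (simp add: N_def o)
  have Nq: "N \<bullet> ?q j = 1" for j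
    using D[of j] by (simp add: N_def q D_def divide_simps flip: add_divide_distrib)
  have inner_q: "w \<bullet> ?q j = (fst w * real_of_rat (L j) + snd w \<bullet> rcol A j) / D j" for w j
    by (simp add: q inner_prod_def add_divide_distrib)
  have inner_o: "w \<bullet> ?o = fst w / real_of_rat \<epsilon>" for w
    by (simp add: o inner_prod_def)
  have in_P: "?o \<in> ?P" "?q j \<in> ?P" for j
    unfolding AL_polyhedron_def by (auto intro: hull_inc)
  have conv: "convex ?P" unfolding AL_polyhedron_def by simp
  have P_subset: "?P \<subseteq> C" if "convex C" "?o \<in> C" "\<And>j. ?q j \<in> C" for C
    unfolding AL_polyhedron_def using that by (intro hull_minimal) auto
  \<comment> \<open>On a column point, \<open>W u\<close> is the slack of that column divided by the
    positive \<open>D j\<close>.\<close>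
  define W :: "real^'d \<Rightarrow> real \<times> (real^'d)" where "W u = (1, - u)" for u
  have Wq: "W u \<bullet> ?q j = (real_of_rat (L j) - u \<bullet> rcol A j) / D j" for u j
    by (simp add: inner_q W_def)
  have Wo: "W u \<bullet> ?o > 0" for u using e by (simp add: inner_o W_def)
  define face where "face u = ?P \<inter> {x. W u \<bullet> x = 0}" for u
  have face: "face u face_of ?P" "?o \<notin> face u" "\<tau> = {j. ?q j \<in> face u}"
    if u: "supports A L \<tau> u" for \<tau> u
  proof -
    have le: "u \<bullet> rcol A j \<le> real_of_rat (L j)" for j
      using u unfolding supports_def by (metis less_eq_real_def)
    have "?P \<subseteq> {x. W u \<bullet> x \<ge> 0}"
      using Wo[of u] le D by (intro P_subset) (auto simp: Wq convex_halfspace_ge less_imp_le)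
    then show "face u face_of ?P"
      unfolding face_def by (intro face_of_Int_supporting_hyperplane_ge conv) auto
    show "?o \<notin> face u" using Wo[of u] by (auto simp: face_def)
    have "j \<in> \<tau> \<longleftrightarrow> real_of_rat (L j) - u \<bullet> rcol A j = 0" for j
      using u unfolding supports_def by (metis diff_gt_0_iff_gt less_irrefl right_minus_eq)
    then show "\<tau> = {j. ?q j \<in> face u}" using in_P D by (auto simp: face_def Wq less_le)
  qed
  show "umbrella A L h \<epsilon> = {\<tau>. \<exists>u. supports A L \<tau> u}"
  proof (intro equalityI subsetI)
    fix \<tau> assume "\<tau> \<in> umbrella A L h \<epsilon>"
    then obtain F where \<tau>: "\<tau> = {j. ?q j \<in> F}" and F: "F face_of ?P" "?o \<notin> F"
      by (auto simp: umbrella_def)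
    have "polytope ?P" unfolding AL_polyhedron_def by (rule polytope_convex_hull) simp
    then have "F exposed_face_of ?P"
      using F(1) exposed_face_of_polyhedron polytope_imp_polyhedron by blast
    then obtain a b where ab: "?P \<subseteq> {x. a \<bullet> x \<le> b}" "F = ?P \<inter> {x. a \<bullet> x = b}"
      by (auto simp: exposed_face_of_def)
    \<comment> \<open>Homogenised supporting functional: nonnegative on the polyhedron and zero
      exactly on \<open>F\<close>. Since the origin is off \<open>F\<close>, its first coordinate is
      positive and can be scaled to 1.\<close>
    define w where "w = b *\<^sub>R N - a"
    have w: "w \<bullet> ?o = b - a \<bullet> ?o" "w \<bullet> ?q j = b - a \<bullet> ?q j" for j
      using No Nq by (auto simp: w_def inner_diff_left)
    have "a \<bullet> ?o \<le> b" "a \<bullet> ?o \<noteq> b" using ab in_P F(2) by auto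
    then have "w \<bullet> ?o > 0" using w(1) by linarith
    then have w0: "fst w > 0" using e by (simp add: inner_o zero_less_divide_iff)
    define u where "u = - (1 / fst w) *\<^sub>R snd w"
    have val: "real_of_rat (L j) - u \<bullet> rcol A j = (b - a \<bullet> ?q j) * D j / fst w" for j
    proof -
      have "(b - a \<bullet> ?q j) * D j = fst w * real_of_rat (L j) + snd w \<bullet> rcol A j"
        using D[of j] by (simp only: w(2)[of j, symmetric] inner_q[of w j]) simp
      then show ?thesis using w0 by (simp add: u_def field_simps)
    qed
    have "supports A L \<tau> u"
      unfolding supports_def
    proof (intro allI conjI impI)
      fix j
      show "u \<bullet> rcol A j = real_of_rat (L j)" if "j \<in> \<tau>"
        using that val[of j] by (auto simp: \<tau> ab(2))
      show "u \<bullet> rcol A j < real_of_rat (L j)" if "j \<notin> \<tau>"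
      proof -
        have "a \<bullet> ?q j \<le> b" "a \<bullet> ?q j \<noteq> b"
          using that ab in_P by (auto simp: \<tau>)
        then have "(b - a \<bullet> ?q j) * D j / fst w > 0"
          using D[of j] w0 by (intro divide_pos_pos mult_pos_pos) auto
        then show ?thesis using val[of j] by simp
      qed
    qed
    then show "\<tau> \<in> {\<tau>. \<exists>u. supports A L \<tau> u}" by blast
  next
    fix \<tau> assume "\<tau> \<in> {\<tau>. \<exists>u. supports A L \<tau> u}"
    then obtain u where "supports A L \<tau> u" by blast
    from face[OF this] show "\<tau> \<in> umbrella A L h \<epsilon>"
      unfolding umbrella_def by blast
  qed
  show "\<tau> \<in> umbrella_dim A L h \<epsilon> (int CARD('d) - 1)"
    if u: "supports A L \<tau> u" and sp: "span (rcol A ` \<tau>) = UNIV"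
  proof -
    let ?F = "face u"
    have "N \<noteq> 0" using e by (auto simp: N_def zero_prod_def)
    \<comment> \<open>The hyperplane has dimension \<open>CARD('d)\<close>, and a proper face has
      smaller dimension than the polyhedron.\<close>
    have "?P \<subseteq> {x. N \<bullet> x = 1}"
      using No Nq by (intro P_subset) (auto simp: convex_hyperplane)
    then have "aff_dim ?P \<le> aff_dim {x. N \<bullet> x = 1}" by (rule aff_dim_subset)
    also have "\<dots> = int CARD('d)"
      using \<open>N \<noteq> 0\<close> by (simp add: aff_dim_hyperplane)
    finally have "aff_dim ?F < int CARD('d)"
      using face_of_aff_dim_lt[OF conv face(1)[OF u]] face(2)[OF u] in_P by force
    \<comment> \<open>The linear span of the face projects onto the whole space, and adjoining 0
      raises the affine dimension by at most one.\<close>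
    moreover have "int CARD('d) \<le> aff_dim ?F + 1"
    proof -
      have "rcol A j \<in> snd ` span ?F" if "j \<in> \<tau>" for j
      proof -
        have "?q j \<in> ?F" using face(3)[OF u] that by blast
        then have "D j *\<^sub>R ?q j \<in> span ?F" by (intro span_scale span_base)
        moreover have "snd (D j *\<^sub>R ?q j) = rcol A j" using D[of j] by (simp add: q)
        ultimately show ?thesis by (metis image_eqI)
      qed
      moreover have "subspace (snd ` span ?F)"
        by (intro linear_subspace_image linear_snd subspace_span)
      ultimately have "span (rcol A ` \<tau>) \<subseteq> snd ` span ?F"
        by (intro span_minimal) auto
      then have "snd ` span ?F = UNIV" using sp by blast
      then have "CARD('d) = dim (snd ` span ?F)" by simp
      also have "\<dots> \<le> dim (span ?F)" by (rule dim_image_le[OF linear_snd])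
      also have "int \<dots> = int (dim (insert 0 ?F))" by (metis dim_span span_insert_0)
      also have "\<dots> = aff_dim (insert 0 ?F)"
        by (rule aff_dim_zero[symmetric]) (simp add: hull_inc)
      also have "\<dots> \<le> aff_dim ?F + 1" by (simp add: aff_dim_insert)
      finally show ?thesis by simp
    qed
    ultimately have "aff_dim ?F = int CARD('d) - 1" by linarith
    then show ?thesis unfolding umbrella_dim_def using face[OF u] by blast
  qed
qed

theorem theorem3p1:
  fixes A :: "'n::finite \<Rightarrow> int^'d::finite" and L :: "'n \<Rightarrow> rat"
    and h :: "int^'d" and \<epsilon> :: rat
  assumes full: "is_full A" and pointed: "is_pointed A"
    and h_pos: "\<forall>j. lin_form h (A j) > 0"
    and eps_pos: "\<epsilon> > 0"
    and eps_small: "\<forall>j. of_int (lin_form h (A j)) > \<epsilon> * \<bar>L j\<bar>"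
  shows "({P. is_prime_ideal P \<and> is_graded A P \<and> grL L (toric_ideal A) \<subseteq> P}
           = I_tau A ` umbrella A L h \<epsilon>)
    \<and> (zero_set (grL L (toric_ideal A))
           = (\<Union>\<tau>\<in>umbrella_dim A L h \<epsilon> (int CARD('d) - 1). closure (orbit A \<tau>)))
    \<and> (zero_set (grL L (toric_ideal A)) = (\<Union>\<tau>\<in>umbrella A L h \<epsilon>. orbit A \<tau>))
    \<and> disjoint_family_on (orbit A) (umbrella A L h \<epsilon>)"
proof -
  let ?U = "umbrella A L h \<epsilon>" and ?Ud = "umbrella_dim A L h \<epsilon> (int CARD('d) - 1)"
    and ?V = "zero_set (grL L (toric_ideal A))"
  have U: "?U = {\<tau>. \<exists>u. supports A L \<tau> u}"
    using umbrella_eq[OF eps_pos eps_small] .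
  have V: "?V = (\<Union>\<tau>\<in>?U. orbit A \<tau>)" unfolding U by (rule zero_set_grL)
  have "?V = (\<Union>\<tau>\<in>?Ud. closure (orbit A \<tau>))"
  proof (intro equalityI subsetI)
    fix \<xi> assume "\<xi> \<in> ?V"
    then obtain \<tau> u where \<xi>: "\<xi> \<in> orbit A \<tau>" and u: "supports A L \<tau> u"
      unfolding V U by blast
    \<comment> \<open>A facet whose orbit closure contains the orbit of \<tau>.\<close>
    obtain \<tau>' u' where "\<tau> \<subseteq> \<tau>'" "supports A L \<tau>' u'" "span (rcol A ` \<tau>') = UNIV"
      using ex_spanning_support[OF full u] by blast
    then have "\<xi> \<in> closure (orbit A \<tau>')" "\<tau>' \<in> ?Ud"
      using \<xi> orbit_subset_closure[OF u] umbrella_dim_spanning[OF eps_pos eps_small] by blast+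
    then show "\<xi> \<in> (\<Union>\<tau>\<in>?Ud. closure (orbit A \<tau>))" by blast
  next
    fix \<xi> assume "\<xi> \<in> (\<Union>\<tau>\<in>?Ud. closure (orbit A \<tau>))"
    then obtain \<tau> where \<tau>: "\<tau> \<in> ?Ud" "\<xi> \<in> closure (orbit A \<tau>)"
      by blast
    have "?Ud \<subseteq> ?U" unfolding umbrella_dim_def umbrella_def by blast
    then have "orbit A \<tau> \<subseteq> ?V" using \<tau>(1) unfolding V by blast
    then have "closure (orbit A \<tau>) \<subseteq> ?V"
      by (rule closure_minimal) (rule closed_zero_set)
    then show "\<xi> \<in> ?V" using \<tau>(2) by blast
  qed
  then show ?thesis using graded_primes_over_grL[of A L] V disjoint_orbits[of A ?U]
    unfolding U by blast
qed

end
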